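(* Let $\phi:(M^m,g)\to (N,h)$ be a non-minimal pseudo-umbilical Riemannian immersion, with biharmonic stress-energy tensor $S_2$. (a) If $m=4$, then $S_2=0$, hence $\nabla S_2=0$. (b) If $m\neq 4$, then $\nabla S_2=0$ if and only if $|\tau(\phi)|$ is constant.
   Context: All manifolds, metrics and maps are smooth; manifolds are connected and without boundary. For a map $\phi:(M^m,g)\to(N,h)$, the tension field is $\tau(\phi)=\operatorname{trace}_g\nabla d\phi$, a section of $\phi^{-1}TN$, and the biharmonic stress-energy tensor is the symmetric $(0,2)$-tensor field on $M$ $$S_2(X,Y)=\tfrac12|\tau(\phi)|^2\langle X,Y\rangle+\langle d\phi,\nabla\tau(\phi)\rangle\langle X,Y\rangle-\langle d\phi(X),\nabla_Y\tau(\phi)\rangle-\langle d\phi(Y),\nabla_X\tau(\phi)\rangle,$$ where $\nabla\tau(\phi)$ uses the pull-back connection on $\phi^{-1}TN$ and $\langle d\phi,\nabla\tau(\phi)\rangle=\sum_i\langle d\phi(e_i),\nabla_{e_i}\tau(\phi)\rangle$ for a local orthonormal frame $\{e_i\}$. A Riemannian immersion is an immersion with $g=\phi^*h$; it is minimal if $\tau(\phi)=0$ identically. With second fundamental form $B=\nabla d\phi$, it is pseudo-umbilical if $\langle B(X,Y),\tau(\phi)\rangle=\frac1m|\tau(\phi)|^2\langle X,Y\rangle$ for all vector fields $X,Y$ on $M$. *)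

theory Defs
  imports "HOL-Analysis.Analysis"
begin

section \<open>Smooth maps between open subsets of Euclidean spaces\<close>

text \<open>On open sets, \<open>Ck_on k S f\<close> says that \<open>f\<close> is of class \<open>C^k\<close>: all iterated
  directional derivatives up to order \<open>k\<close> exist and are continuous.\<close>

primrec Ck_on ::
  "nat \<Rightarrow> 'v::euclidean_space set \<Rightarrow> ('v \<Rightarrow> 'w::real_normed_vector) \<Rightarrow> bool" where
  "Ck_on 0 S f \<longleftrightarrow> continuous_on S f"
| "Ck_on (Suc k) S f \<longleftrightarrow>
     (\<forall>x\<in>S. f differentiable (at x)) \<and>
     (\<forall>v. Ck_on k S (\<lambda>x. frechet_derivative f (at x) v))"

definition smooth_on :: "'v::euclidean_space set \<Rightarrow> ('v \<Rightarrow> 'w::real_normed_vector) \<Rightarrow> bool" where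
  "smooth_on S f \<longleftrightarrow> (\<forall>k. Ck_on k S f)"

abbreviation dd :: "('v::euclidean_space \<Rightarrow> 'w::real_normed_vector) \<Rightarrow> 'v \<Rightarrow> 'v \<Rightarrow> 'w" where
  "dd f x u \<equiv> frechet_derivative f (at x) u"


section \<open>Smooth manifolds\<close>

text \<open>The points of a manifold are the elements of a type of class \<open>t2_space\<close> and
  \<open>second_countable_topology\<close>; its dimension is \<open>CARD('m)\<close>. A chart is a pair of its domain
  and its coordinate map; only the values of the latter on the domain matter.\<close>

type_synonym ('a, 'm) chart = "'a set \<times> ('a \<Rightarrow> real ^ 'm)"

definition chart_inv :: "('a, 'm) chart \<Rightarrow> real ^ 'm \<Rightarrow> 'a" where
  "chart_inv c = inv_into (fst c) (snd c)"

definition is_chart :: "('a::topological_space, 'm::finite) chart \<Rightarrow> bool" where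
  "is_chart c \<longleftrightarrow> open (fst c) \<and> open (snd c ` fst c) \<and>
     homeomorphism (fst c) (snd c ` fst c) (snd c) (chart_inv c)"

text \<open>The expression of a map \<open>\<phi>\<close> in the charts \<open>c\<close> and \<open>d\<close>, and its domain. For
  \<open>\<phi> = id\<close> this is the change of coordinates from \<open>c\<close> to \<open>d\<close>.\<close>

definition local_rep ::
  "('a, 'm) chart \<Rightarrow> ('b, 'n) chart \<Rightarrow> ('a \<Rightarrow> 'b) \<Rightarrow> real ^ 'm \<Rightarrow> real ^ 'n" where
  "local_rep c d \<phi> = snd d \<circ> \<phi> \<circ> chart_inv c"

definition local_dom ::
  "('a, 'm) chart \<Rightarrow> ('b, 'n) chart \<Rightarrow> ('a \<Rightarrow> 'b) \<Rightarrow> (real ^ 'm) set" where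
  "local_dom c d \<phi> = snd c ` (fst c \<inter> \<phi> -` fst d)"

definition smooth_atlas ::
  "('a::{t2_space,second_countable_topology}, 'm::finite) chart set \<Rightarrow> bool" where
  "smooth_atlas A \<longleftrightarrow>
     (\<forall>c\<in>A. is_chart c) \<and> (\<Union>c\<in>A. fst c) = UNIV \<and>
     (\<forall>c\<in>A. \<forall>c'\<in>A. smooth_on (local_dom c c' id) (local_rep c c' id))"

definition smooth_map ::
  "('a::{t2_space,second_countable_topology}, 'm::finite) chart set \<Rightarrow>
   ('b::{t2_space,second_countable_topology}, 'n::finite) chart set \<Rightarrow> ('a \<Rightarrow> 'b) \<Rightarrow> bool" where
  "smooth_map A B \<phi> \<longleftrightarrow>
     continuous_on UNIV \<phi> \<and>
     (\<forall>c\<in>A. \<forall>d\<in>B. smooth_on (local_dom c d \<phi>) (local_rep c d \<phi>))"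


section \<open>Riemannian metrics\<close>

text \<open>The inner product of two vectors for a metric with component matrix \<open>G\<close>.\<close>

definition ip :: "real ^ 'm ^ 'm \<Rightarrow> real ^ 'm \<Rightarrow> real ^ 'm \<Rightarrow> real" where
  "ip G u v = u \<bullet> (G *v v)"

text \<open>A tensor field is given by its components in every chart of the atlas. A metric \<open>g\<close>
  thus assigns to a chart \<open>c\<close> the matrix function \<open>g c\<close> on the coordinate range of \<open>c\<close>, whose
  entries are the inner products of the coordinate vector fields; the last conjunct is the
  transformation rule of a \<open>(0,2)\<close>-tensor.\<close>

definition riemannian_metric ::
  "('a::{t2_space,second_countable_topology}, 'm::finite) chart set \<Rightarrow>
   (('a, 'm) chart \<Rightarrow> real ^ 'm \<Rightarrow> real ^ 'm ^ 'm) \<Rightarrow> bool" where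
  "riemannian_metric A g \<longleftrightarrow>
     (\<forall>c\<in>A. smooth_on (snd c ` fst c) (g c) \<and>
        (\<forall>x \<in> snd c ` fst c.
           transpose (g c x) = g c x \<and> (\<forall>u. u \<noteq> 0 \<longrightarrow> ip (g c x) u u > 0))) \<and>
     (\<forall>c\<in>A. \<forall>c'\<in>A. \<forall>x \<in> local_dom c c' id. \<forall>u v.
        ip (g c x) u v =
        ip (g c' (local_rep c c' id x)) (dd (local_rep c c' id) x u) (dd (local_rep c c' id) x v))"

definition riemannian_manifold ::
  "('a::{t2_space,second_countable_topology}, 'm::finite) chart set \<Rightarrow>
   (('a, 'm) chart \<Rightarrow> real ^ 'm \<Rightarrow> real ^ 'm ^ 'm) \<Rightarrow> bool" where
  "riemannian_manifold A g \<longleftrightarrow>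
     smooth_atlas A \<and> connected (UNIV :: 'a set) \<and> riemannian_metric A g"

definition riemannian_immersion ::
  "('a::{t2_space,second_countable_topology}, 'm::finite) chart set \<Rightarrow>
   (('a, 'm) chart \<Rightarrow> real ^ 'm \<Rightarrow> real ^ 'm ^ 'm) \<Rightarrow>
   ('b::{t2_space,second_countable_topology}, 'n::finite) chart set \<Rightarrow>
   (('b, 'n) chart \<Rightarrow> real ^ 'n \<Rightarrow> real ^ 'n ^ 'n) \<Rightarrow> ('a \<Rightarrow> 'b) \<Rightarrow> bool" where
  "riemannian_immersion A g B h \<phi> \<longleftrightarrow>
     smooth_map A B \<phi> \<and>
     (\<forall>c\<in>A. \<forall>d\<in>B. \<forall>x \<in> local_dom c d \<phi>.
        inj (dd (local_rep c d \<phi>) x) \<and>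
        (\<forall>u v. ip (g c x) u v =
           ip (h d (local_rep c d \<phi> x)) (dd (local_rep c d \<phi>) x u) (dd (local_rep c d \<phi>) x v)))"

text \<open>The trace of a bilinear map with respect to the inner product with matrix \<open>G\<close>, in
  terms of the inverse matrix; it agrees with the sum over an orthonormal basis.\<close>

definition metric_trace ::
  "real ^ 'm ^ 'm \<Rightarrow> (real ^ 'm \<Rightarrow> real ^ 'm \<Rightarrow> 'w::real_vector) \<Rightarrow> 'w" where
  "metric_trace G b =
     (\<Sum>i\<in>UNIV. \<Sum>j\<in>UNIV. (matrix_inv G $ i $ j) *\<^sub>R b (axis i 1) (axis j 1))"

lemma metric_trace_orthonormal:
  fixes G :: "real ^ 'm ^ 'm" and b :: "real ^ 'm \<Rightarrow> real ^ 'm \<Rightarrow> 'w::real_vector"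
    and e :: "'m \<Rightarrow> real ^ 'm"
  assumes bilin: "\<And>u. linear (b u)" "\<And>v. linear (\<lambda>u. b u v)"
    and orth: "\<And>i j. ip G (e i) (e j) = (if i = j then 1 else 0)"
  shows "metric_trace G b = (\<Sum>k\<in>UNIV. b (e k) (e k))"
proof -
  define E where "E = (\<chi> i k. e k $ i)"
  have col: "e k = (\<Sum>i\<in>UNIV. E $ i $ k *\<^sub>R axis i 1)" for k
    by (simp add: E_def vec_eq_iff axis_def if_distrib cong: if_cong)
  have "transpose E ** (G ** E) = mat 1"
  proof -
    have "(transpose E ** (G ** E)) $ i $ j = ip G (e i) (e j)" for i j
      by (simp add: ip_def E_def matrix_matrix_mult_def transpose_def inner_vec_def
          matrix_vector_mult_def)
    then show ?thesis
      by (simp add: vec_eq_iff orth mat_def)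
  qed
  then have "(G ** E) ** transpose E = mat 1"
    by (simp add: matrix_left_right_inverse)
  then have inv1: "G ** (E ** transpose E) = mat 1"
    by (simp add: matrix_mul_assoc)
  then have inv2: "(E ** transpose E) ** G = mat 1"
    by (simp add: matrix_left_right_inverse)
  have "G ** matrix_inv G = mat 1 \<and> matrix_inv G ** G = mat 1"
    unfolding matrix_inv_def by (rule someI[where x = "E ** transpose E"]) (use inv1 inv2 in simp)
  then have "matrix_inv G = E ** transpose E"
    by (metis inv1 matrix_mul_assoc matrix_mul_lid matrix_mul_rid)
  then have inv: "matrix_inv G $ i $ j = (\<Sum>k\<in>UNIV. E $ i $ k * E $ j $ k)" for i j
    by (simp add: matrix_matrix_mult_def transpose_def)
  have "b (e k) (e k) =
      (\<Sum>i\<in>UNIV. \<Sum>j\<in>UNIV. (E $ i $ k * E $ j $ k) *\<^sub>R b (axis i 1) (axis j 1))" for k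
    unfolding col[of k]
    by (simp add: linear_sum[OF bilin(1)] linear_sum[OF bilin(2)] linear_scale[OF bilin(1)]
        linear_scale[OF bilin(2)] scaleR_sum_right)
      (subst sum.swap, simp add: mult.commute)
  then have "(\<Sum>k\<in>UNIV. b (e k) (e k)) =
      (\<Sum>k\<in>UNIV. \<Sum>i\<in>UNIV. \<Sum>j\<in>UNIV. (E $ i $ k * E $ j $ k) *\<^sub>R b (axis i 1) (axis j 1))"
    by simp
  also have "\<dots> = (\<Sum>i\<in>UNIV. \<Sum>k\<in>UNIV. \<Sum>j\<in>UNIV. (E $ i $ k * E $ j $ k) *\<^sub>R b (axis i 1) (axis j 1))"
    by (rule sum.swap)
  also have "\<dots> = (\<Sum>i\<in>UNIV. \<Sum>j\<in>UNIV. \<Sum>k\<in>UNIV. (E $ i $ k * E $ j $ k) *\<^sub>R b (axis i 1) (axis j 1))"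
    by (rule sum.cong[OF refl], rule sum.swap)
  finally show ?thesis
    by (simp add: metric_trace_def inv scaleR_sum_left)
qed


section \<open>Connections in coordinates\<close>

text \<open>In this section \<open>G\<close> and \<open>H\<close> are the component matrices of the metrics of \<open>M\<close> and
  \<open>N\<close> in a pair of charts, as functions of the coordinates, \<open>F\<close> is the coordinate expression
  of the map, and \<open>x\<close> is a point in coordinates. Tangent vectors are given by their
  components in the coordinate frame.\<close>

definition christoffel ::
  "(real ^ 'm \<Rightarrow> real ^ 'm ^ 'm) \<Rightarrow> real ^ 'm \<Rightarrow> 'm::finite \<Rightarrow> 'm \<Rightarrow> 'm \<Rightarrow> real" where
  "christoffel G x k i j = 1 / 2 * (\<Sum>l\<in>UNIV. matrix_inv (G x) $ k $ l *
     (dd (\<lambda>y. G y $ j $ l) x (axis i 1) + dd (\<lambda>y. G y $ i $ l) x (axis j 1)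
      - dd (\<lambda>y. G y $ i $ j) x (axis l 1)))"

definition christoffel_form ::
  "(real ^ 'm \<Rightarrow> real ^ 'm ^ 'm) \<Rightarrow> real ^ 'm \<Rightarrow> real ^ 'm \<Rightarrow> real ^ 'm \<Rightarrow> real ^ 'm::finite" where
  "christoffel_form G x u v =
     (\<chi> k. \<Sum>i\<in>UNIV. \<Sum>j\<in>UNIV. christoffel G x k i j * u $ i * v $ j)"

text \<open>The Levi-Civita derivative of the vector field \<open>Y\<close> in direction \<open>u\<close>, and the
  derivative for the pull-back connection of a vector field \<open>V\<close> along \<open>F\<close>.\<close>

definition nabla ::
  "(real ^ 'm \<Rightarrow> real ^ 'm ^ 'm) \<Rightarrow> (real ^ 'm \<Rightarrow> real ^ 'm) \<Rightarrow> real ^ 'm \<Rightarrow> real ^ 'm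
    \<Rightarrow> real ^ 'm::finite" where
  "nabla G Y x u = dd Y x u + christoffel_form G x u (Y x)"

definition nabla_along ::
  "(real ^ 'n \<Rightarrow> real ^ 'n ^ 'n) \<Rightarrow> (real ^ 'm \<Rightarrow> real ^ 'n) \<Rightarrow> (real ^ 'm \<Rightarrow> real ^ 'n)
    \<Rightarrow> real ^ 'm::finite \<Rightarrow> real ^ 'm \<Rightarrow> real ^ 'n::finite" where
  "nabla_along H F V x u = dd V x u + christoffel_form H (F x) (dd F x u) (V x)"

text \<open>The second fundamental form: the covariant derivative of the differential, so
  \<open>(u, v)\<close> is sent to \<open>\<nabla>\<^sub>u (dF v) - dF (\<nabla>\<^sub>u v)\<close>. By tensoriality it suffices to extend \<open>v\<close> to the
  vector field with constant components; likewise in \<open>cov_deriv\<close> below.\<close>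

definition second_fund_form ::
  "(real ^ 'm \<Rightarrow> real ^ 'm ^ 'm) \<Rightarrow> (real ^ 'n \<Rightarrow> real ^ 'n ^ 'n) \<Rightarrow> (real ^ 'm \<Rightarrow> real ^ 'n)
    \<Rightarrow> real ^ 'm::finite \<Rightarrow> real ^ 'm \<Rightarrow> real ^ 'm \<Rightarrow> real ^ 'n::finite" where
  "second_fund_form G H F x u v =
     nabla_along H F (\<lambda>y. dd F y v) x u - dd F x (nabla G (\<lambda>y. v) x u)"

definition tension ::
  "(real ^ 'm \<Rightarrow> real ^ 'm ^ 'm) \<Rightarrow> (real ^ 'n \<Rightarrow> real ^ 'n ^ 'n) \<Rightarrow> (real ^ 'm \<Rightarrow> real ^ 'n)
    \<Rightarrow> real ^ 'm::finite \<Rightarrow> real ^ 'n::finite" where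
  "tension G H F x = metric_trace (G x) (second_fund_form G H F x)"

definition bistress ::
  "(real ^ 'm \<Rightarrow> real ^ 'm ^ 'm) \<Rightarrow> (real ^ 'n \<Rightarrow> real ^ 'n ^ 'n) \<Rightarrow>
   (real ^ 'm \<Rightarrow> real ^ 'n::finite) \<Rightarrow> real ^ 'm::finite \<Rightarrow> real ^ 'm \<Rightarrow> real ^ 'm \<Rightarrow> real" where
  "bistress G H F x u v =
     (let \<tau> = tension G H F; n\<tau> = nabla_along H F \<tau> x
      in 1 / 2 * ip (H (F x)) (\<tau> x) (\<tau> x) * ip (G x) u v
         + metric_trace (G x) (\<lambda>a b. ip (H (F x)) (dd F x a) (n\<tau> b)) * ip (G x) u v
         - ip (H (F x)) (dd F x u) (n\<tau> v)
         - ip (H (F x)) (dd F x v) (n\<tau> u))"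

text \<open>The derivative \<open>(\<nabla>\<^sub>w S)(u, v)\<close> of a \<open>(0,2)\<close>-tensor field \<open>S\<close>.\<close>

definition cov_deriv ::
  "(real ^ 'm \<Rightarrow> real ^ 'm ^ 'm) \<Rightarrow> (real ^ 'm \<Rightarrow> real ^ 'm \<Rightarrow> real ^ 'm \<Rightarrow> real)
    \<Rightarrow> real ^ 'm::finite \<Rightarrow> real ^ 'm \<Rightarrow> real ^ 'm \<Rightarrow> real ^ 'm \<Rightarrow> real" where
  "cov_deriv G S x w u v =
     dd (\<lambda>y. S y u v) x w - S x (nabla G (\<lambda>y. u) x w) v - S x u (nabla G (\<lambda>y. v) x w)"


section \<open>Global notions\<close>

text \<open>A property of the tensor fields attached to a map is required in all pairs of charts.\<close>

definition minimal ::
  "('a, 'm::finite) chart set \<Rightarrow> (('a, 'm) chart \<Rightarrow> real ^ 'm \<Rightarrow> real ^ 'm ^ 'm) \<Rightarrow>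
   ('b, 'n::finite) chart set \<Rightarrow> (('b, 'n) chart \<Rightarrow> real ^ 'n \<Rightarrow> real ^ 'n ^ 'n) \<Rightarrow>
   ('a \<Rightarrow> 'b) \<Rightarrow> bool" where
  "minimal A g B h \<phi> \<longleftrightarrow>
     (\<forall>c\<in>A. \<forall>d\<in>B. \<forall>x \<in> local_dom c d \<phi>. tension (g c) (h d) (local_rep c d \<phi>) x = 0)"

definition pseudo_umbilical ::
  "('a, 'm::finite) chart set \<Rightarrow> (('a, 'm) chart \<Rightarrow> real ^ 'm \<Rightarrow> real ^ 'm ^ 'm) \<Rightarrow>
   ('b, 'n::finite) chart set \<Rightarrow> (('b, 'n) chart \<Rightarrow> real ^ 'n \<Rightarrow> real ^ 'n ^ 'n) \<Rightarrow>
   ('a \<Rightarrow> 'b) \<Rightarrow> bool" where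
  "pseudo_umbilical A g B h \<phi> \<longleftrightarrow>
     (\<forall>c\<in>A. \<forall>d\<in>B. \<forall>x \<in> local_dom c d \<phi>. \<forall>u v.
        (let F = local_rep c d \<phi>; \<tau> = tension (g c) (h d) F x
         in ip (h d (F x)) (second_fund_form (g c) (h d) F x u v) \<tau> =
            1 / real CARD('m) * ip (h d (F x)) \<tau> \<tau> * ip (g c x) u v))"

definition bistress_vanishes ::
  "('a, 'm::finite) chart set \<Rightarrow> (('a, 'm) chart \<Rightarrow> real ^ 'm \<Rightarrow> real ^ 'm ^ 'm) \<Rightarrow>
   ('b, 'n::finite) chart set \<Rightarrow> (('b, 'n) chart \<Rightarrow> real ^ 'n \<Rightarrow> real ^ 'n ^ 'n) \<Rightarrow>
   ('a \<Rightarrow> 'b) \<Rightarrow> bool" where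
  "bistress_vanishes A g B h \<phi> \<longleftrightarrow>
     (\<forall>c\<in>A. \<forall>d\<in>B. \<forall>x \<in> local_dom c d \<phi>. \<forall>u v.
        bistress (g c) (h d) (local_rep c d \<phi>) x u v = 0)"

definition bistress_parallel ::
  "('a, 'm::finite) chart set \<Rightarrow> (('a, 'm) chart \<Rightarrow> real ^ 'm \<Rightarrow> real ^ 'm ^ 'm) \<Rightarrow>
   ('b, 'n::finite) chart set \<Rightarrow> (('b, 'n) chart \<Rightarrow> real ^ 'n \<Rightarrow> real ^ 'n ^ 'n) \<Rightarrow>
   ('a \<Rightarrow> 'b) \<Rightarrow> bool" where
  "bistress_parallel A g B h \<phi> \<longleftrightarrow>
     (\<forall>c\<in>A. \<forall>d\<in>B. \<forall>x \<in> local_dom c d \<phi>. \<forall>w u v.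
        cov_deriv (g c) (bistress (g c) (h d) (local_rep c d \<phi>)) x w u v = 0)"

definition constant_tension_norm ::
  "('a, 'm::finite) chart set \<Rightarrow> (('a, 'm) chart \<Rightarrow> real ^ 'm \<Rightarrow> real ^ 'm ^ 'm) \<Rightarrow>
   ('b, 'n::finite) chart set \<Rightarrow> (('b, 'n) chart \<Rightarrow> real ^ 'n \<Rightarrow> real ^ 'n ^ 'n) \<Rightarrow>
   ('a \<Rightarrow> 'b) \<Rightarrow> bool" where
  "constant_tension_norm A g B h \<phi> \<longleftrightarrow>
     (\<exists>K. \<forall>c\<in>A. \<forall>d\<in>B. \<forall>x \<in> local_dom c d \<phi>.
        (let F = local_rep c d \<phi>; \<tau> = tension (g c) (h d) F x
         in sqrt (ip (h d (F x)) \<tau> \<tau>) = K))"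

end

theory Submission
  imports Defs
begin

text \<open>The second fundamental form \<open>B\<close> of a Riemannian immersion, and hence \<open>\<tau>\<close>, is normal.
  Differentiating \<open>\<langle>\<tau>, d\<phi> X\<rangle> = 0\<close> gives \<open>\<langle>\<nabla>\<^sub>Y \<tau>, d\<phi> X\<rangle> = - \<langle>\<tau>, B(X, Y)\<rangle>\<close>, which is
  \<open>- |\<tau>|\<^sup>2 \<langle>X, Y\<rangle> / m\<close> in the pseudo-umbilical case. Therefore \<open>S\<^sub>2 = (2/m - 1/2) |\<tau>|\<^sup>2 g\<close>, and
  \<open>\<nabla>S\<^sub>2 = (2/m - 1/2) d|\<tau>|\<^sup>2 \<otimes> g\<close> because \<open>g\<close> is parallel. To pass from \<open>d|\<tau>|\<^sup>2 = 0\<close> in each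
  pair of charts to a constant on the connected manifold, one needs that \<open>|\<tau>|\<^sup>2\<close> does not depend
  on the charts. A change of coordinates is an isometric immersion of codimension zero, so its
  second fundamental form is normal to the whole tangent space and vanishes; the invariance
  follows from the composition formula for \<open>B\<close>.\<close>

section \<open>Calculus\<close>

lemma frechet_derivative_eqI:
  "(f has_derivative f') (at x) \<Longrightarrow> dd f x = f'"
  by (rule frechet_derivative_at[symmetric])

lemma has_derivative_dd: "f differentiable (at x) \<Longrightarrow> (f has_derivative dd f x) (at x)"
  by (simp add: frechet_derivative_works)

lemma linear_dd: "f differentiable (at x) \<Longrightarrow> linear (dd f x)"
  using has_derivative_dd has_derivative_linear by blast

lemma frechet_derivative_cong_open:
  assumes "open U" "x \<in> U" "\<And>y. y \<in> U \<Longrightarrow> f y = g y"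
  shows "dd f x = dd g x"
proof (cases "f differentiable (at x)")
  case True
  then show ?thesis using frechet_derivative_transform_within_open assms by blast
next
  case False
  \<comment> \<open>\<open>frechet_derivative\<close> is a choice from the predicate
    \<open>has_derivative\<close>; equal predicates yield the same chosen value, even when no
    derivative exists.\<close>
  have "(f has_derivative D) (at x) \<longleftrightarrow> (g has_derivative D) (at x)" for D
    using has_derivative_transform_within_open assms by metis
  then show ?thesis unfolding frechet_derivative_def by simp
qed

lemma differentiable_cong_open:
  assumes "f differentiable (at x)" "open U" "x \<in> U" "\<And>y. y \<in> U \<Longrightarrow> f y = g y"
  shows "g differentiable (at x)"
  using assms unfolding differentiable_def by (metis has_derivative_transform_within_open)

lemma differentiable_prod:
  fixes f :: "'i \<Rightarrow> 'v::real_normed_vector \<Rightarrow> real"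
  assumes "finite I" "\<And>i. i \<in> I \<Longrightarrow> f i differentiable (at x)"
  shows "(\<lambda>y. \<Prod>i\<in>I. f i y) differentiable (at x)"
  using assms by (induction rule: finite_induct) auto

lemma differentiable_vec_iff:
  fixes f :: "'v::real_normed_vector \<Rightarrow> real ^ 'n"
  shows "f differentiable (at x) \<longleftrightarrow> (\<forall>i. (\<lambda>y. f y $ i) differentiable (at x))"
proof
  show "\<forall>i. (\<lambda>y. f y $ i) differentiable (at x)" if "f differentiable (at x)"
    using that unfolding differentiable_def
    by (blast intro: bounded_linear.has_derivative[OF bounded_linear_vec_nth])
next
  assume *: "\<forall>i. (\<lambda>y. f y $ i) differentiable (at x)"
  have "(\<lambda>y. \<Sum>i\<in>UNIV. f y $ i *\<^sub>R axis i 1) differentiable (at x)"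
    using * by (intro differentiable_sum) auto
  moreover have "f = (\<lambda>y. \<Sum>i\<in>UNIV. f y $ i *\<^sub>R axis i 1)"
    by (rule ext) (simp add: vec_eq_iff axis_def if_distrib cong: if_cong)
  ultimately show "f differentiable (at x)" by (rule ssubst[rotated])
qed

lemma differentiable_vec_nth:
  fixes f :: "'v::real_normed_vector \<Rightarrow> ('w::real_normed_vector) ^ 'n"
  shows "f differentiable (at x) \<Longrightarrow> (\<lambda>y. f y $ i) differentiable (at x)"
  unfolding differentiable_def
  by (blast intro: bounded_linear.has_derivative[OF bounded_linear_vec_nth])

lemma dd_vec_nth:
  fixes f :: "'v::euclidean_space \<Rightarrow> ('w::real_normed_vector) ^ 'n"
  assumes "f differentiable (at x)"
  shows "dd (\<lambda>y. f y $ i) x v = dd f x v $ i"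
proof -
  have "((\<lambda>y. f y $ i) has_derivative (\<lambda>v. dd f x v $ i)) (at x)"
    by (rule bounded_linear.has_derivative[OF bounded_linear_vec_nth has_derivative_dd[OF assms]])
  then show ?thesis by (simp add: frechet_derivative_eqI)
qed

section \<open>Determinants and matrix inverses of differentiable matrix functions\<close>

lemma differentiable_det:
  fixes A :: "'v::real_normed_vector \<Rightarrow> real ^ 'n ^ 'n"
  assumes "\<And>i j. (\<lambda>y. A y $ i $ j) differentiable (at x)"
  shows "(\<lambda>y. det (A y)) differentiable (at x)"
  unfolding det_def using assms
  by (intro differentiable_sum ballI differentiable_mult differentiable_prod finite_permutations)
    auto

lemma matrix_inv_mult:
  fixes G :: "real ^ 'm ^ 'm"
  assumes "det G \<noteq> 0"
  shows "matrix_inv G ** G = mat 1" "G ** matrix_inv G = mat 1"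
proof -
  have "\<exists>X. G ** X = mat 1 \<and> X ** G = mat 1"
    using assms by (simp add: invertible_det_nz[symmetric] invertible_def)
  then have "G ** matrix_inv G = mat 1 \<and> matrix_inv G ** G = mat 1"
    unfolding matrix_inv_def by (rule someI_ex)
  then show "matrix_inv G ** G = mat 1" "G ** matrix_inv G = mat 1" by auto
qed

lemma matrix_inv_unique:
  fixes G :: "real ^ 'm ^ 'm"
  assumes "det G \<noteq> 0" "G ** X = mat 1"
  shows "matrix_inv G = X"
  by (metis assms matrix_inv_mult(1) matrix_mul_assoc matrix_mul_lid matrix_mul_rid)

text \<open>Column \<open>j\<close> of the inverse solves \<open>A *v z = axis j 1\<close>, so
  Cramer's rule applies. Each entry becomes a quotient of determinants, which reduces
  differentiability of the inverse to that of \<open>det\<close>.\<close>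

lemma matrix_inv_cramer:
  fixes A :: "real ^ 'n ^ 'n"
  assumes "det A \<noteq> 0"
  shows "matrix_inv A $ i $ j =
    det (\<chi> a b. if b = i then (axis j 1 :: real ^ 'n) $ a else A $ a $ b) / det A"
proof -
  have "A *v (matrix_inv A *v axis j 1) = axis j 1"
    using assms by (simp add: matrix_vector_mul_assoc matrix_inv_mult)
  then have "matrix_inv A *v axis j 1 =
      (\<chi> k. det (\<chi> a b. if b = k then (axis j 1 :: real ^ 'n) $ a else A $ a $ b) / det A)"
    using cramer[OF assms] by blast
  moreover have "(matrix_inv A *v axis j 1) $ i = matrix_inv A $ i $ j"
    by (simp add: matrix_vector_mul_component inner_axis)
  ultimately show ?thesis by simp
qed

lemma differentiable_matrix_inv:
  fixes A :: "'v::real_normed_vector \<Rightarrow> real ^ 'n ^ 'n"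
  assumes A: "A differentiable (at x)" and U: "open U" "x \<in> U" "\<And>y. y \<in> U \<Longrightarrow> det (A y) \<noteq> 0"
  shows "(\<lambda>y. matrix_inv (A y) $ i $ j) differentiable (at x)"
proof (rule differentiable_cong_open[OF _ U(1,2)])
  have entry: "(\<lambda>y. A y $ a $ b) differentiable (at x)" for a b
    by (intro differentiable_vec_nth A)
  show "(\<lambda>y. det (\<chi> a b. if b = i then (axis j 1 :: real ^ 'n) $ a else A y $ a $ b) / det (A y))
      differentiable (at x)"
  proof (intro differentiable_divide differentiable_det)
    show "(\<lambda>y. (\<chi> a b. if b = i then (axis j 1 :: real ^ 'n) $ a else A y $ a $ b) $ k $ l)
        differentiable (at x)" for k l
      by (cases "l = i") (simp_all add: entry)
  qed (use entry U in auto)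
qed (simp add: matrix_inv_cramer U(3))

lemma Ck_on_subset: "Ck_on k S f \<Longrightarrow> T \<subseteq> S \<Longrightarrow> Ck_on k T f"
  by (induction k arbitrary: f) (auto intro: continuous_on_subset)

lemma smooth_on_subset: "smooth_on S f \<Longrightarrow> T \<subseteq> S \<Longrightarrow> smooth_on T f"
  unfolding smooth_on_def using Ck_on_subset by blast

lemma smooth_on_differentiable: "smooth_on S f \<Longrightarrow> x \<in> S \<Longrightarrow> f differentiable (at x)"
  unfolding smooth_on_def by (metis Ck_on.simps(2))

lemma smooth_on_dd: "smooth_on S f \<Longrightarrow> smooth_on S (\<lambda>x. dd f x v)"
  unfolding smooth_on_def by (metis Ck_on.simps(2))

section \<open>Symmetry of second derivatives\<close>

text \<open>The second difference is symmetric in \<open>u\<close> and \<open>v\<close>, hence so is its limit. The proof applies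
  the mean value theorem in direction \<open>u\<close> and then the differentiability of \<open>dd f y u\<close> at \<open>x\<close>.\<close>

lemma second_difference_tendsto:
  fixes f :: "'v::euclidean_space \<Rightarrow> real"
  assumes U: "open U" "x \<in> U" and f: "\<And>y. y \<in> U \<Longrightarrow> f differentiable (at y)"
    and f2: "(\<lambda>y. dd f y u) differentiable (at x)"
  shows "((\<lambda>t. (f (x + t *\<^sub>R u + t *\<^sub>R v) - f (x + t *\<^sub>R u) - f (x + t *\<^sub>R v) + f x) / t\<^sup>2)
    \<longlongrightarrow> dd (\<lambda>y. dd f y u) x v) (at_right 0)"
proof (rule tendstoI)
  fix e :: real assume e: "e > 0"
  define L where "L = dd (\<lambda>y. dd f y u) x"
  have L: "((\<lambda>y. dd f y u) has_derivative L) (at x)"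
    unfolding L_def by (rule has_derivative_dd[OF f2])
  have linL: "linear L" using L has_derivative_linear by blast
  \<comment> \<open>The summand 1 keeps \<open>C\<close> positive when \<open>u\<close> and
    \<open>v\<close> vanish, and it makes \<open>(norm u + norm v) / C < 1\<close> strict in the
    final estimate.\<close>
  define C where "C = 2 * (norm u + norm v) + 1"
  have C: "C > 0" by (simp add: C_def add_nonneg_pos)
  obtain r where r: "r > 0" "ball x r \<subseteq> U"
    using U openE by blast
  obtain d where d: "d > 0"
    "\<And>y. norm (y - x) < d \<Longrightarrow> norm (dd f y u - dd f x u - L (y - x)) \<le> e / (2 * C) * norm (y - x)"
  proof -
    have "e / (2 * C) > 0" using e C by simp
    then show ?thesis using L that unfolding has_derivative_at_alt by blast
  qed
  \<comment> \<open>For \<open>0 < t < s\<close> and \<open>a\<close>, \<open>b\<close> between 0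
    and \<open>t\<close>, the vector \<open>a *\<^sub>R u + b *\<^sub>R v\<close> is shorter than
    both \<open>r\<close> and \<open>d\<close>: the points used stay in \<open>U\<close>, and the
    error bound for \<open>L\<close> applies to them.\<close>
  define s where "s = min r d / C"
  have s: "s > 0" using r d C by (simp add: s_def)
  have close: "norm (a *\<^sub>R u + b *\<^sub>R v) < min r d \<and> norm (a *\<^sub>R u + b *\<^sub>R v) \<le> t * (norm u + norm v)"
    if "0 < t" "t < s" "0 \<le> a" "a \<le> t" "0 \<le> b" "b \<le> t" for a b t
  proof -
    have "norm (a *\<^sub>R u + b *\<^sub>R v) \<le> a * norm u + b * norm v"
      by (rule norm_triangle_le) (use that in simp)
    also have "\<dots> \<le> t * norm u + t * norm v"
      by (intro add_mono mult_right_mono) (use that in auto)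
    finally have 1: "norm (a *\<^sub>R u + b *\<^sub>R v) \<le> t * (norm u + norm v)" by (simp add: algebra_simps)
    have "t * (norm u + norm v) \<le> t * C"
      by (intro mult_left_mono) (use that in \<open>auto simp: C_def\<close>)
    also have "\<dots> < s * C" using that C by simp
    also have "\<dots> = min r d" using C by (simp add: s_def)
    finally show ?thesis using 1 by linarith
  qed
  have main: "dist ((f (x + t *\<^sub>R u + t *\<^sub>R v) - f (x + t *\<^sub>R u) - f (x + t *\<^sub>R v) + f x) / t\<^sup>2) (L v) < e"
    if t: "0 < t" "t < s" for t
  proof -
    \<comment> \<open>The second difference is \<open>p t - p 0\<close>. The summand
      \<open>0 *\<^sub>R v\<close> lets \<open>der1\<close> serve both terms, with
      \<open>b = t\<close> and \<open>b = 0\<close>.\<close>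
    define p where "p a = f (x + (a *\<^sub>R u + t *\<^sub>R v)) - f (x + (a *\<^sub>R u + 0 *\<^sub>R v))" for a
    have inU: "x + (a *\<^sub>R u + b *\<^sub>R v) \<in> U" if "0 \<le> a" "a \<le> t" "0 \<le> b" "b \<le> t" for a b
    proof (rule subsetD[OF r(2)])
      have "dist (x + (a *\<^sub>R u + b *\<^sub>R v)) x < r"
        unfolding dist_norm add_diff_cancel_left' using close[OF t that] by simp
      then show "x + (a *\<^sub>R u + b *\<^sub>R v) \<in> ball x r" by (simp add: dist_commute)
    qed
    have der1: "((\<lambda>a. f (x + (a *\<^sub>R u + b *\<^sub>R v))) has_real_derivative
        dd f (x + (a *\<^sub>R u + b *\<^sub>R v)) u) (at a)"
      if "0 \<le> a" "a \<le> t" "0 \<le> b" "b \<le> t" for a b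
    proof -
      have D: "(f has_derivative dd f (x + (a *\<^sub>R u + b *\<^sub>R v))) (at (x + (a *\<^sub>R u + b *\<^sub>R v)))"
        by (rule has_derivative_dd[OF f[OF inU[OF that]]])
      have "((\<lambda>a. x + (a *\<^sub>R u + b *\<^sub>R v)) has_derivative (\<lambda>h. h *\<^sub>R u)) (at a)"
        by (auto intro!: derivative_eq_intros)
      from diff_chain_at[OF this D]
      have "((\<lambda>a. f (x + (a *\<^sub>R u + b *\<^sub>R v))) has_derivative
          (\<lambda>h. dd f (x + (a *\<^sub>R u + b *\<^sub>R v)) (h *\<^sub>R u))) (at a)"
        by (simp add: o_def)
      moreover have "dd f (x + (a *\<^sub>R u + b *\<^sub>R v)) (h *\<^sub>R u) =
          dd f (x + (a *\<^sub>R u + b *\<^sub>R v)) u * h" for h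
        using linear_scale[OF has_derivative_linear[OF D]] by simp
      ultimately show ?thesis by (simp add: has_field_derivative_def)
    qed
    have der_p: "(p has_real_derivative
        dd f (x + (a *\<^sub>R u + t *\<^sub>R v)) u - dd f (x + (a *\<^sub>R u + 0 *\<^sub>R v)) u) (at a)"
      if "0 \<le> a" "a \<le> t" for a
      unfolding p_def by (rule DERIV_diff[OF der1 der1]) (use that t in auto)
    obtain z where z: "0 < z" "z < t"
      "p t - p 0 = (t - 0) * (dd f (x + (z *\<^sub>R u + t *\<^sub>R v)) u - dd f (x + (z *\<^sub>R u + 0 *\<^sub>R v)) u)"
      using MVT2[OF t(1) der_p] by blast
    define w1 where "w1 = z *\<^sub>R u + t *\<^sub>R v"
    define w0 where "w0 = z *\<^sub>R u + 0 *\<^sub>R v"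
    have w: "norm w1 < d" "norm w0 < d" "norm w1 \<le> t * (norm u + norm v)"
      "norm w0 \<le> t * (norm u + norm v)"
      using close[OF t, of z t] close[OF t, of z 0] z t by (auto simp: w1_def w0_def)
    \<comment> \<open>The unknown \<open>z\<close> from the mean value theorem cancels in this
      difference, leaving exactly \<open>t\<close> times the expected limit.\<close>
    have LL: "L w1 - L w0 = t * L v"
      by (simp add: w1_def w0_def linear_add[OF linL] linear_scale[OF linL])
    have eC: "e / (2 * C) \<ge> 0" using e C by simp
    have est: "\<bar>dd f (x + w) u - dd f x u - L w\<bar> \<le> e / (2 * C) * (t * (norm u + norm v))"
      if "norm w < d" "norm w \<le> t * (norm u + norm v)" for w
      using d(2)[of "x + w"] that mult_left_mono[OF that(2) eC] by simp
    have "\<bar>(dd f (x + w1) u - dd f (x + w0) u) - t * L v\<bar>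
        \<le> 2 * (e / (2 * C) * (t * (norm u + norm v)))"
      using est[OF w(1,3)] est[OF w(2,4)] LL by linarith
    also have "\<dots> = e * t * ((norm u + norm v) / C)" by simp
    also have "\<dots> < e * t * 1"
      using e t C by (intro mult_strict_left_mono) (auto simp: C_def divide_less_eq add_nonneg_pos)
    finally have *: "\<bar>(dd f (x + w1) u - dd f (x + w0) u) - t * L v\<bar> < e * t" by simp
    have "f (x + t *\<^sub>R u + t *\<^sub>R v) - f (x + t *\<^sub>R u) - f (x + t *\<^sub>R v) + f x = p t - p 0"
      by (simp add: p_def add.assoc)
    also have "\<dots> = t * (dd f (x + w1) u - dd f (x + w0) u)"
      using z by (simp add: w1_def w0_def)
    finally have "(f (x + t *\<^sub>R u + t *\<^sub>R v) - f (x + t *\<^sub>R u) - f (x + t *\<^sub>R v) + f x) / t\<^sup>2 - L v =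
        t * (dd f (x + w1) u - dd f (x + w0) u) / t\<^sup>2 - L v"
      by (rule arg_cong)
    also have "\<dots> = ((dd f (x + w1) u - dd f (x + w0) u) - t * L v) / t"
      using t by (simp add: diff_divide_distrib power2_eq_square)
    finally have "(f (x + t *\<^sub>R u + t *\<^sub>R v) - f (x + t *\<^sub>R u) - f (x + t *\<^sub>R v) + f x) / t\<^sup>2 - L v =
        ((dd f (x + w1) u - dd f (x + w0) u) - t * L v) / t" .
    then show ?thesis using * t by (simp add: dist_real_def divide_less_eq)
  qed
  show "\<forall>\<^sub>F t in at_right 0.
      dist ((f (x + t *\<^sub>R u + t *\<^sub>R v) - f (x + t *\<^sub>R u) - f (x + t *\<^sub>R v) + f x) / t\<^sup>2)
        (dd (\<lambda>y. dd f y u) x v) < e"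
    unfolding eventually_at_right_field using main s by (auto simp: L_def)
qed

lemma symmetric_second_derivative_real:
  fixes f :: "'v::euclidean_space \<Rightarrow> real"
  assumes "open U" "x \<in> U" "\<And>y. y \<in> U \<Longrightarrow> f differentiable (at y)"
    and "\<And>v. (\<lambda>y. dd f y v) differentiable (at x)"
  shows "dd (\<lambda>y. dd f y u) x v = dd (\<lambda>y. dd f y v) x u"
proof -
  have "(\<lambda>t. (f (x + t *\<^sub>R u + t *\<^sub>R v) - f (x + t *\<^sub>R u) - f (x + t *\<^sub>R v) + f x) / t\<^sup>2) =
      (\<lambda>t. (f (x + t *\<^sub>R v + t *\<^sub>R u) - f (x + t *\<^sub>R v) - f (x + t *\<^sub>R u) + f x) / t\<^sup>2)"
    by (simp add: algebra_simps)
  then show ?thesis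
    using second_difference_tendsto[OF assms, of u v] second_difference_tendsto[OF assms, of v u]
    by (metis (no_types, lifting) tendsto_unique trivial_limit_at_right_real)
qed

lemma symmetric_second_derivative:
  fixes f :: "'v::euclidean_space \<Rightarrow> real ^ 'n"
  assumes U: "open U" "x \<in> U" and f: "\<And>y. y \<in> U \<Longrightarrow> f differentiable (at y)"
    and f2: "\<And>v. (\<lambda>y. dd f y v) differentiable (at x)"
  shows "dd (\<lambda>y. dd f y u) x v = dd (\<lambda>y. dd f y v) x u"
proof -
  have comp: "dd (\<lambda>y. dd (\<lambda>z. f z $ i) y a) x b = dd (\<lambda>y. dd f y a) x b $ i" for a b i
  proof -
    have "dd (\<lambda>y. dd (\<lambda>z. f z $ i) y a) x = dd (\<lambda>y. dd f y a $ i) x"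
      by (rule frechet_derivative_cong_open[OF U]) (simp add: dd_vec_nth f)
    then show ?thesis by (simp add: dd_vec_nth f2)
  qed
  have "dd (\<lambda>y. dd (\<lambda>z. f z $ i) y u) x v = dd (\<lambda>y. dd (\<lambda>z. f z $ i) y v) x u" for i
  proof (rule symmetric_second_derivative_real[OF U])
    show "(\<lambda>z. f z $ i) differentiable (at y)" if "y \<in> U" for y
      by (rule differentiable_vec_nth[OF f[OF that]])
    show "(\<lambda>y. dd (\<lambda>z. f z $ i) y w) differentiable (at x)" for w
      by (rule differentiable_cong_open[OF differentiable_vec_nth[OF f2[of w], of i] U])
        (simp add: dd_vec_nth f)
  qed
  then show ?thesis by (simp add: vec_eq_iff comp)
qed

section \<open>Differentiating a differential at a moving point in a moving direction\<close>

lemma dd_expand: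
  fixes K :: "real ^ 'n \<Rightarrow> 'w::real_normed_vector"
  assumes "K differentiable (at z)"
  shows "dd K z w = (\<Sum>i\<in>UNIV. w $ i *\<^sub>R dd K z (axis i 1))"
proof -
  have "w = (\<Sum>i\<in>UNIV. w $ i *\<^sub>R axis i 1)"
    by (simp add: vec_eq_iff axis_def if_distrib cong: if_cong)
  then have "dd K z w = dd K z (\<Sum>i\<in>UNIV. w $ i *\<^sub>R axis i 1)" by simp
  then show ?thesis by (simp add: linear_sum linear_scale linear_dd assms)
qed

text \<open>Smoothness of \<open>K\<close> speaks of \<open>dd K\<close> in fixed directions only.
  Expanding \<open>X y\<close> in the standard basis leaves a sum of scalars times
  \<open>dd K (P y) (axis i 1)\<close>, to which the product and chain rules apply.\<close>

lemma has_derivative_dd_apply: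
  fixes K :: "real ^ 'n \<Rightarrow> 'w::real_normed_vector" and P X :: "'v::real_normed_vector \<Rightarrow> real ^ 'n"
  assumes U: "open U" "x \<in> U" and V: "open V" "\<And>y. y \<in> U \<Longrightarrow> P y \<in> V"
    and K: "smooth_on V K"
    and P: "(P has_derivative P') (at x)" and X: "(X has_derivative X') (at x)"
  shows "((\<lambda>y. dd K (P y) (X y)) has_derivative
    (\<lambda>u. dd (\<lambda>z. dd K z (X x)) (P x) (P' u) + dd K (P x) (X' u))) (at x)"
proof (rule has_derivative_transform_within_open[OF _ U])
  have PV: "P x \<in> V" by (rule V(2)[OF U(2)])
  have K1: "K differentiable (at z)" if "z \<in> V" for z
    by (rule smooth_on_differentiable[OF K that])
  have K2: "(\<lambda>z. dd K z w) differentiable (at (P x))" for w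
    by (rule smooth_on_differentiable[OF smooth_on_dd[OF K] PV])
  show "(\<Sum>i\<in>UNIV. X y $ i *\<^sub>R dd K (P y) (axis i 1)) = dd K (P y) (X y)" if "y \<in> U" for y
    by (rule dd_expand[symmetric, OF K1[OF V(2)[OF that]]])
  \<comment> \<open>The same expansion with the direction frozen at \<open>X x\<close> identifies
    the first summand of the derivative.\<close>
  have "((\<lambda>z. \<Sum>i\<in>UNIV. X x $ i *\<^sub>R dd K z (axis i 1)) has_derivative
      (\<lambda>p. \<Sum>i\<in>UNIV. X x $ i *\<^sub>R dd (\<lambda>z. dd K z (axis i 1)) (P x) p)) (at (P x))"
    by (intro has_derivative_sum has_derivative_scaleR_right has_derivative_dd K2)
  then have "((\<lambda>z. dd K z (X x)) has_derivative
      (\<lambda>p. \<Sum>i\<in>UNIV. X x $ i *\<^sub>R dd (\<lambda>z. dd K z (axis i 1)) (P x) p)) (at (P x))"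
    by (rule has_derivative_transform_within_open[OF _ V(1) PV])
      (rule dd_expand[symmetric, OF K1])
  then have E: "dd (\<lambda>z. dd K z (X x)) (P x) =
      (\<lambda>p. \<Sum>i\<in>UNIV. X x $ i *\<^sub>R dd (\<lambda>z. dd K z (axis i 1)) (P x) p)"
    by (rule frechet_derivative_eqI)
  have Xi: "((\<lambda>y. X y $ i) has_derivative (\<lambda>u. X' u $ i)) (at x)" for i
    by (rule bounded_linear.has_derivative[OF bounded_linear_vec_nth X])
  have Ki: "((\<lambda>y. dd K (P y) (axis i 1)) has_derivative
      (\<lambda>u. dd (\<lambda>z. dd K z (axis i 1)) (P x) (P' u))) (at x)" for i
    using diff_chain_at[OF P has_derivative_dd[OF K2]] by (simp add: o_def)
  have "((\<lambda>y. \<Sum>i\<in>UNIV. X y $ i *\<^sub>R dd K (P y) (axis i 1)) has_derivative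
      (\<lambda>u. \<Sum>i\<in>UNIV. X x $ i *\<^sub>R dd (\<lambda>z. dd K z (axis i 1)) (P x) (P' u)
        + X' u $ i *\<^sub>R dd K (P x) (axis i 1))) (at x)"
    by (intro has_derivative_sum has_derivative_scaleR Xi Ki)
  then show "((\<lambda>y. \<Sum>i\<in>UNIV. X y $ i *\<^sub>R dd K (P y) (axis i 1)) has_derivative
      (\<lambda>u. dd (\<lambda>z. dd K z (X x)) (P x) (P' u) + dd K (P x) (X' u))) (at x)"
    by (simp add: E dd_expand[OF K1[OF PV], of "X' _"] sum.distrib)
qed

section \<open>Inner products\<close>

lemma ip_sum: "ip G u v = (\<Sum>i\<in>UNIV. \<Sum>j\<in>UNIV. G $ i $ j * u $ i * v $ j)"
  by (simp add: ip_def inner_vec_def matrix_vector_mult_def sum_distrib_left mult_ac)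

lemma ip_linear [simp]:
  "ip G (u + u') v = ip G u v + ip G u' v" "ip G u (v + v') = ip G u v + ip G u v'"
  "ip G (u - u') v = ip G u v - ip G u' v" "ip G u (v - v') = ip G u v - ip G u v'"
  "ip G (r *\<^sub>R u) v = r * ip G u v" "ip G u (r *\<^sub>R v) = r * ip G u v"
  "ip G 0 v = 0" "ip G u 0 = 0" "ip G (- u) v = - ip G u v" "ip G u (- v) = - ip G u v"
  by (simp_all add: ip_def inner_simps matrix_vector_right_distrib matrix_vector_mult_diff_distrib
      matrix_vector_mult_scaleR inner_add_left)
    (metis (no_types, opaque_lifting) diff_0 inner_minus_right matrix_vector_mult_0_right
      matrix_vector_mult_diff_distrib)

lemma ip_sum_left: "ip G (sum f I) v = (\<Sum>i\<in>I. ip G (f i) v)"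
  by (simp add: ip_def inner_sum_left)

lemma ip_commute: "transpose G = G \<Longrightarrow> ip G u v = ip G v u"
  by (metis dot_lmul_matrix inner_commute ip_def transpose_matrix_vector)

lemma bounded_bilinear_matrix_vector_mult:
  "bounded_bilinear ((*v) :: real ^ 'n ^ 'm \<Rightarrow> real ^ 'n \<Rightarrow> real ^ 'm)"
  unfolding bilinear_conv_bounded_bilinear[symmetric] bilinear_def
  by (auto intro!: linearI simp: matrix_vector_mult_add_rdistrib scaleR_matrix_vector_assoc
      matrix_vector_right_distrib matrix_vector_mult_scaleR)

lemma has_derivative_ip:
  assumes "(G has_derivative G') (at x)" "(u has_derivative u') (at x)" "(v has_derivative v') (at x)"
  shows "((\<lambda>y. ip (G y) (u y) (v y)) has_derivative
    (\<lambda>w. ip (G' w) (u x) (v x) + ip (G x) (u' w) (v x) + ip (G x) (u x) (v' w))) (at x)"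
  unfolding ip_def
  by (rule has_derivative_eq_rhs[OF has_derivative_inner[OF assms(2)
        bounded_bilinear.FDERIV[OF bounded_bilinear_matrix_vector_mult assms(1,3)]]])
    (auto simp: inner_simps)

lemma ip_pos_imp_det:
  assumes "\<And>u. u \<noteq> 0 \<Longrightarrow> ip G u u > 0"
  shows "det G \<noteq> 0"
proof -
  have "inj ((*v) G)"
    unfolding linear_injective_0[OF matrix_vector_mul_linear]
    using assms by (metis inner_zero_right ip_def less_irrefl)
  then have "\<exists>X. X ** G = mat 1" by (simp add: matrix_left_invertible_injective)
  then show ?thesis by (simp add: invertible_det_nz[symmetric] invertible_left_inverse)
qed

section \<open>Traces with respect to a metric\<close>

text \<open>By symmetry of \<open>G\<close>, the double sum is the ordinary trace of
  \<open>matrix_inv G ** G\<close>, an identity matrix.\<close>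

lemma metric_trace_ip:
  fixes G :: "real ^ 'm ^ 'm"
  assumes "det G \<noteq> 0" "transpose G = G"
  shows "metric_trace G (\<lambda>u v. ip G u v) = real CARD('m)"
proof -
  have ax: "ip G (axis i 1) (axis j 1) = G $ i $ j" for i j
    by (simp add: ip_def inner_axis' matrix_vector_mul_component inner_axis)
  have sym: "G $ i $ j = G $ j $ i" for i j
    by (metis assms(2) transpose_def vec_lambda_beta)
  have "metric_trace G (\<lambda>u v. ip G u v) = (\<Sum>i\<in>UNIV. (matrix_inv G ** G) $ i $ i)"
    by (simp add: metric_trace_def ax matrix_matrix_mult_def)
      (simp add: sym cong: sum.cong)
  then show ?thesis by (simp add: matrix_inv_mult assms mat_def)
qed

lemma metric_trace_scale: "metric_trace G (\<lambda>u v. r * b u v) = r * metric_trace G b" for r :: real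
  by (simp add: metric_trace_def sum_distrib_left mult_ac)

lemma ip_metric_trace: "ip H (metric_trace G b) w = metric_trace G (\<lambda>u v. ip H (b u v) w)"
  by (simp add: metric_trace_def ip_sum_left)

lemma linear_metric_trace:
  assumes "linear f"
  shows "f (metric_trace G b) = metric_trace G (\<lambda>u v. f (b u v))"
  by (simp add: metric_trace_def linear_sum[OF assms] linear_scale[OF assms])

lemma sum_swap_triple:
  "(\<Sum>j\<in>J. \<Sum>k\<in>K. \<Sum>l\<in>L. f j k l) = (\<Sum>k\<in>K. \<Sum>l\<in>L. \<Sum>j\<in>J. f j k l)"
  by (subst sum.swap, rule sum.cong[OF refl], rule sum.swap)

lemma sum_swap_pairs:
  "(\<Sum>i\<in>I. \<Sum>j\<in>J. \<Sum>k\<in>K. \<Sum>l\<in>L. f i j k l) = (\<Sum>k\<in>K. \<Sum>l\<in>L. \<Sum>i\<in>I. \<Sum>j\<in>J. f i j k l)"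
proof -
  have "(\<Sum>i\<in>I. \<Sum>j\<in>J. \<Sum>k\<in>K. \<Sum>l\<in>L. f i j k l) = (\<Sum>i\<in>I. \<Sum>k\<in>K. \<Sum>l\<in>L. \<Sum>j\<in>J. f i j k l)"
    by (rule sum.cong[OF refl], rule sum_swap_triple)
  also have "\<dots> = (\<Sum>k\<in>K. \<Sum>l\<in>L. \<Sum>i\<in>I. \<Sum>j\<in>J. f i j k l)"
    by (rule sum_swap_triple)
  finally show ?thesis .
qed

text \<open>If \<open>M\<close> is the matrix of \<open>P\<close>, then \<open>pull\<close> says
  \<open>G = transpose M ** G' ** M\<close>. Since one-sided inverses of square matrices are
  two-sided, \<open>matrix_inv G' = M ** matrix_inv G ** transpose M\<close>, and this is how the
  two double sums correspond.\<close>

lemma metric_trace_pullback: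
  fixes G G' :: "real ^ 'm ^ 'm" and b :: "real ^ 'm \<Rightarrow> real ^ 'm \<Rightarrow> 'w::real_vector"
  assumes bilin: "\<And>u. linear (b u)" "\<And>v. linear (\<lambda>u. b u v)" and P: "linear P"
    and det: "det G \<noteq> 0" "det G' \<noteq> 0"
    and pull: "\<And>u v. ip G u v = ip G' (P u) (P v)"
  shows "metric_trace G (\<lambda>u v. b (P u) (P v)) = metric_trace G' b"
proof -
  define M where "M = matrix P"
  have PM: "P u = M *v u" for u by (simp add: M_def P matrix_works)
  have "G = transpose M ** G' ** M"
  proof -
    have "u \<bullet> (G *v v) = u \<bullet> ((transpose M ** G' ** M) *v v)" for u v
      using pull[of u v] unfolding ip_def PM
      by (metis dot_lmul_matrix matrix_vector_mul_assoc transpose_matrix_vector vector_transpose_matrix)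
    then have "G *v v = (transpose M ** G' ** M) *v v" for v
      using vector_eq_rdot by (metis inner_commute)
    then show ?thesis by (simp add: matrix_eq)
  qed
  then have G: "G = (transpose M ** G') ** M" .
  have "(transpose M ** G') ** (M ** matrix_inv G) = mat 1"
    using matrix_inv_mult(2)[OF det(1)] G by (simp add: matrix_mul_assoc)
  then have "(M ** matrix_inv G) ** (transpose M ** G') = mat 1"
    by (simp add: matrix_left_right_inverse)
  then have "((M ** matrix_inv G) ** transpose M) ** G' = mat 1"
    by (simp add: matrix_mul_assoc)
  then have "matrix_inv G' = (M ** matrix_inv G) ** transpose M"
    by (intro matrix_inv_unique det) (simp add: matrix_left_right_inverse)
  then have inv: "matrix_inv G' $ k $ l =
      (\<Sum>j\<in>UNIV. \<Sum>i\<in>UNIV. M $ k $ i * matrix_inv G $ i $ j * M $ l $ j)" for k l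
    by (simp add: matrix_matrix_mult_def transpose_def sum_distrib_right)
  have col: "P (axis i 1) = (\<Sum>k\<in>UNIV. M $ k $ i *\<^sub>R axis k 1)" for i
  proof -
    have "(M *v axis i 1) $ k = M $ k $ i" for k
      by (simp add: matrix_vector_mul_component inner_axis)
    then show ?thesis by (simp add: PM vec_eq_iff axis_def if_distrib cong: if_cong)
  qed
  have bP: "b (P (axis i 1)) (P (axis j 1)) =
      (\<Sum>k\<in>UNIV. \<Sum>l\<in>UNIV. (M $ k $ i * M $ l $ j) *\<^sub>R b (axis k 1) (axis l 1))" for i j
    unfolding col
    by (simp add: linear_sum[OF bilin(1)] linear_sum[OF bilin(2)] linear_scale[OF bilin(1)]
        linear_scale[OF bilin(2)] scaleR_sum_right)
      (subst sum.swap, simp add: mult.commute)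
  have "metric_trace G (\<lambda>u v. b (P u) (P v)) = (\<Sum>i\<in>UNIV. \<Sum>j\<in>UNIV. \<Sum>k\<in>UNIV. \<Sum>l\<in>UNIV.
      (M $ k $ i * matrix_inv G $ i $ j * M $ l $ j) *\<^sub>R b (axis k 1) (axis l 1))"
    by (simp add: metric_trace_def bP scaleR_sum_right mult_ac)
  also have "\<dots> = (\<Sum>k\<in>UNIV. \<Sum>l\<in>UNIV. \<Sum>i\<in>UNIV. \<Sum>j\<in>UNIV.
      (M $ k $ i * matrix_inv G $ i $ j * M $ l $ j) *\<^sub>R b (axis k 1) (axis l 1))"
    by (rule sum_swap_pairs)
  also have "\<dots> = metric_trace G' b"
    unfolding metric_trace_def inv
    by (intro sum.cong refl) (subst sum.swap, simp add: scaleR_sum_left)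
  finally show ?thesis .
qed

section \<open>Riemannian metrics on open sets\<close>

lemma christoffel_form_linear [simp]:
  "christoffel_form G x (u + u') v = christoffel_form G x u v + christoffel_form G x u' v"
  "christoffel_form G x u (v + v') = christoffel_form G x u v + christoffel_form G x u v'"
  "christoffel_form G x (r *\<^sub>R u) v = r *\<^sub>R christoffel_form G x u v"
  "christoffel_form G x u (r *\<^sub>R v) = r *\<^sub>R christoffel_form G x u v"
  by (simp_all add: christoffel_form_def vec_eq_iff sum.distrib algebra_simps sum_distrib_left)

lemma nabla_const: "nabla G (\<lambda>y. v) x u = christoffel_form G x u v"
  by (simp add: nabla_def)

text \<open>Here \<open>U\<close> stands for an open part of the range of a chart and
  \<open>G\<close> for the component matrix of the metric, so that the local geometry is developed
  before charts enter.\<close>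

locale riemannian_domain =
  fixes U :: "(real ^ 'm::finite) set" and G :: "real ^ 'm \<Rightarrow> real ^ 'm ^ 'm"
  assumes open_domain: "open U"
    and smooth_metric: "smooth_on U G"
    and symmetric: "x \<in> U \<Longrightarrow> transpose (G x) = G x"
    and positive: "x \<in> U \<Longrightarrow> u \<noteq> 0 \<Longrightarrow> ip (G x) u u > 0"
begin

lemma ip_sym: "x \<in> U \<Longrightarrow> ip (G x) u v = ip (G x) v u"
  by (rule ip_commute[OF symmetric])

lemma det_nonzero: "x \<in> U \<Longrightarrow> det (G x) \<noteq> 0"
  by (rule ip_pos_imp_det[OF positive])

lemma differentiable_metric: "x \<in> U \<Longrightarrow> G differentiable (at x)"
  using smooth_metric by (rule smooth_on_differentiable)

lemma entry_sym:
  assumes "x \<in> U"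
  shows "G x $ i $ j = G x $ j $ i"
proof -
  have "G x $ i $ j = transpose (G x) $ j $ i" by (simp add: transpose_def)
  then show ?thesis by (simp add: symmetric[OF assms])
qed

lemma dd_entry: "x \<in> U \<Longrightarrow> dd (\<lambda>y. G y $ i $ j) x v = dd G x v $ i $ j"
  by (simp add: dd_vec_nth differentiable_vec_nth differentiable_metric)

lemma symmetric_dd:
  assumes "x \<in> U"
  shows "dd G x v $ i $ j = dd G x v $ j $ i"
proof -
  have "dd (\<lambda>y. G y $ i $ j) x = dd (\<lambda>y. G y $ j $ i) x"
    by (rule frechet_derivative_cong_open[OF open_domain assms entry_sym])
  then show ?thesis using dd_entry[OF assms, of i j v] dd_entry[OF assms, of j i v] by simp
qed

lemma ip_dd_sym:
  assumes "x \<in> U"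
  shows "ip (dd G x w) u v = ip (dd G x w) v u"
proof (rule ip_commute)
  show "transpose (dd G x w) = dd G x w"
    by (simp add: vec_eq_iff transpose_def) (intro allI symmetric_dd[OF assms])
qed

lemma ip_unique:
  assumes "x \<in> U" "\<And>w. ip (G x) u w = ip (G x) v w"
  shows "u = v"
proof (rule ccontr)
  assume "u \<noteq> v"
  then have "ip (G x) (u - v) (u - v) > 0" by (intro positive assms(1)) simp
  then show False using assms(2)[of "u - v"] by (simp only: ip_linear(3))
qed

lemma ip_dd_expand:
  assumes "x \<in> U"
  shows "ip (dd G x u) v w =
    (\<Sum>i\<in>UNIV. \<Sum>j\<in>UNIV. \<Sum>l\<in>UNIV. dd G x (axis i 1) $ j $ l * u $ i * v $ j * w $ l)"
proof -
  note D = dd_expand[OF differentiable_metric[OF assms], of u]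
  have "ip (dd G x u) v w =
      (\<Sum>j\<in>UNIV. \<Sum>l\<in>UNIV. \<Sum>i\<in>UNIV. dd G x (axis i 1) $ j $ l * u $ i * v $ j * w $ l)"
    by (simp add: ip_sum D sum_distrib_left mult_ac)
  also have "\<dots> = (\<Sum>i\<in>UNIV. \<Sum>j\<in>UNIV. \<Sum>l\<in>UNIV. dd G x (axis i 1) $ j $ l * u $ i * v $ j * w $ l)"
    by (rule sum_swap_triple[symmetric])
  finally show ?thesis .
qed

section \<open>The Koszul formula and the two defining properties of the Levi-Civita
  connection\<close>

text \<open>Lowering the upper index cancels \<open>matrix_inv (G x)\<close>; what is left are the
  Christoffel symbols of the first kind.\<close>

lemma christoffel_lower:
  assumes "x \<in> U"
  shows "(\<Sum>k\<in>UNIV. G x $ p $ k * christoffel G x k i j) =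
    1 / 2 * (dd G x (axis i 1) $ j $ p + dd G x (axis j 1) $ i $ p - dd G x (axis p 1) $ i $ j)"
proof -
  define E where "E l = dd G x (axis i 1) $ j $ l + dd G x (axis j 1) $ i $ l
    - dd G x (axis l 1) $ i $ j" for l
  have GI: "(\<Sum>k\<in>UNIV. G x $ p $ k * matrix_inv (G x) $ k $ l) = (if p = l then 1 else 0)" for l
  proof -
    have "(G x ** matrix_inv (G x)) $ p $ l = (if p = l then 1 else 0)"
      by (simp add: matrix_inv_mult det_nonzero assms mat_def)
    then show ?thesis by (simp add: matrix_matrix_mult_def)
  qed
  have "(\<Sum>k\<in>UNIV. G x $ p $ k * christoffel G x k i j) =
      (\<Sum>k\<in>UNIV. \<Sum>l\<in>UNIV. 1 / 2 * (G x $ p $ k * matrix_inv (G x) $ k $ l) * E l)"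
    by (simp add: christoffel_def dd_entry assms E_def[symmetric] sum_distrib_left mult_ac
        sum_divide_distrib)
  also have "\<dots> = (\<Sum>l\<in>UNIV. 1 / 2 * (\<Sum>k\<in>UNIV. G x $ p $ k * matrix_inv (G x) $ k $ l) * E l)"
    by (subst sum.swap) (simp add: sum_distrib_left sum_distrib_right)
  also have "\<dots> = 1 / 2 * E p"
    by (simp add: GI if_distrib if_distribR cong: if_cong)
  finally show ?thesis by (simp add: E_def)
qed

text \<open>For fields with constant components \<open>christoffel_form G x u v\<close> is the
  Levi-Civita derivative. Such fields have vanishing brackets, so of the Koszul formula only the
  three derivatives of the metric remain.\<close>

lemma koszul:
  assumes "x \<in> U"
  shows "ip (G x) (christoffel_form G x u v) w =
    1 / 2 * (ip (dd G x u) v w + ip (dd G x v) u w - ip (dd G x w) u v)"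
proof -
  define D where "D i j l = dd G x (axis i 1) $ j $ l" for i j l
  have "ip (G x) (christoffel_form G x u v) w = ip (G x) w (christoffel_form G x u v)"
    by (rule ip_sym[OF assms])
  also have "\<dots> = (\<Sum>l\<in>UNIV. \<Sum>k\<in>UNIV. \<Sum>i\<in>UNIV. \<Sum>j\<in>UNIV.
      (G x $ l $ k * christoffel G x k i j) * (u $ i * v $ j * w $ l))"
    by (simp add: ip_sum christoffel_form_def sum_distrib_left mult_ac)
  also have "\<dots> = (\<Sum>l\<in>UNIV. \<Sum>i\<in>UNIV. \<Sum>j\<in>UNIV.
      (\<Sum>k\<in>UNIV. G x $ l $ k * christoffel G x k i j) * (u $ i * v $ j * w $ l))"
    by (rule sum.cong[OF refl], subst sum_swap_triple) (simp add: sum_distrib_right)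
  also have "\<dots> = (\<Sum>i\<in>UNIV. \<Sum>j\<in>UNIV. \<Sum>l\<in>UNIV.
      (\<Sum>k\<in>UNIV. G x $ l $ k * christoffel G x k i j) * (u $ i * v $ j * w $ l))"
    by (rule sum_swap_triple)
  also have "\<dots> = (\<Sum>i\<in>UNIV. \<Sum>j\<in>UNIV. \<Sum>l\<in>UNIV.
      1 / 2 * (D i j l * u $ i * v $ j * w $ l + D j i l * v $ j * u $ i * w $ l
        - D l i j * w $ l * u $ i * v $ j))"
    by (intro sum.cong refl, simp only: christoffel_lower[OF assms] D_def[symmetric])
      (simp add: field_simps)
  also have "\<dots> = 1 / 2 * ((\<Sum>i\<in>UNIV. \<Sum>j\<in>UNIV. \<Sum>l\<in>UNIV. D i j l * u $ i * v $ j * w $ l)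
      + (\<Sum>i\<in>UNIV. \<Sum>j\<in>UNIV. \<Sum>l\<in>UNIV. D j i l * v $ j * u $ i * w $ l)
      - (\<Sum>i\<in>UNIV. \<Sum>j\<in>UNIV. \<Sum>l\<in>UNIV. D l i j * w $ l * u $ i * v $ j))"
    by (simp add: sum.distrib sum_subtractf sum_distrib_left[symmetric] sum_divide_distrib[symmetric])
  also have "(\<Sum>i\<in>UNIV. \<Sum>j\<in>UNIV. \<Sum>l\<in>UNIV. D j i l * v $ j * u $ i * w $ l) = ip (dd G x v) u w"
    unfolding ip_dd_expand[OF assms] D_def by (rule sum.swap)
  also have "(\<Sum>i\<in>UNIV. \<Sum>j\<in>UNIV. \<Sum>l\<in>UNIV. D l i j * w $ l * u $ i * v $ j) = ip (dd G x w) u v"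
    unfolding ip_dd_expand[OF assms] D_def by (rule sum_swap_triple[symmetric])
  finally show ?thesis by (simp add: ip_dd_expand assms D_def)
qed

text \<open>The right side of \<open>koszul\<close> is symmetric in \<open>u\<close> and
  \<open>v\<close>, and the metric is nondegenerate: the connection is torsion-free.\<close>

lemma christoffel_form_sym: "x \<in> U \<Longrightarrow> christoffel_form G x u v = christoffel_form G x v u"
  by (rule ip_unique) (auto simp: koszul ip_dd_sym)

text \<open>Adding \<open>koszul\<close> for \<open>w, u, v\<close> and for \<open>w, v, u\<close>,
  the derivatives of the metric along \<open>u\<close> and \<open>v\<close> cancel. With constant
  components this is the statement that the metric is parallel.\<close>

lemma metric_compatible:
  assumes "x \<in> U"
  shows "ip (G x) (christoffel_form G x w u) v + ip (G x) u (christoffel_form G x w v) =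
    ip (dd G x w) u v"
proof -
  have "ip (G x) u (christoffel_form G x w v) = ip (G x) (christoffel_form G x w v) u"
    by (rule ip_sym[OF assms])
  then show ?thesis
    using koszul[OF assms, of w u v] koszul[OF assms, of w v u]
      ip_dd_sym[OF assms, of w v u] ip_dd_sym[OF assms, of u v w] ip_dd_sym[OF assms, of v u w]
    by (simp add: field_simps)
qed

lemma differentiable_christoffel:
  assumes "x \<in> U"
  shows "(\<lambda>y. christoffel G y k i j) differentiable (at x)"
proof -
  have inv: "(\<lambda>y. matrix_inv (G y) $ a $ b) differentiable (at x)" for a b
    by (rule differentiable_matrix_inv[OF differentiable_metric[OF assms] open_domain assms
          det_nonzero])
  have "(\<lambda>y. dd G y v $ a $ b) differentiable (at x)" for v a b
    by (intro differentiable_vec_nth smooth_on_differentiable[OF smooth_on_dd[OF smooth_metric]]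
        assms)
  then have dG: "(\<lambda>y. dd (\<lambda>z. G z $ a $ b) y v) differentiable (at x)" for v a b
    by (rule differentiable_cong_open[OF _ open_domain assms]) (simp add: dd_entry)
  show ?thesis
    unfolding christoffel_def using inv dG by (intro differentiable_mult differentiable_sum) auto
qed

lemma differentiable_christoffel_form:
  assumes "P x \<in> U" "P differentiable (at x)" "X differentiable (at x)" "Y differentiable (at x)"
  shows "(\<lambda>y. christoffel_form G (P y) (X y) (Y y)) differentiable (at x)"
proof -
  have "(\<lambda>y. christoffel G (P y) k i j) differentiable (at x)" for k i j
    by (rule differentiable_compose[OF differentiable_christoffel[OF assms(1)] assms(2)])
  then show ?thesis
    using assms(3,4) unfolding differentiable_vec_iff[where f = "\<lambda>y. christoffel_form G (P y) (X y) (Y y)"]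
    by (auto simp: christoffel_form_def intro!: differentiable_sum differentiable_mult
        differentiable_vec_nth)
qed

text \<open>As the metric is parallel, the Christoffel terms of \<open>cov_deriv\<close> absorb the
  derivative of \<open>G\<close>, and only that of the factor \<open>f\<close> survives.\<close>

lemma cov_deriv_conformal:
  assumes x: "x \<in> U" and f: "f differentiable (at x)"
    and S: "\<And>y u v. y \<in> U \<Longrightarrow> S y u v = f y * ip (G y) u v"
  shows "cov_deriv G S x w u v = dd f x w * ip (G x) u v"
proof -
  have dip: "((\<lambda>y. ip (G y) u v) has_derivative (\<lambda>w. ip (dd G x w) u v)) (at x)"
    using has_derivative_ip[OF has_derivative_dd[OF differentiable_metric[OF x]]
        has_derivative_const has_derivative_const, of u v] by simp
  have "dd (\<lambda>y. S y u v) x = dd (\<lambda>y. f y * ip (G y) u v) x"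
    by (rule frechet_derivative_cong_open[OF open_domain x]) (simp add: S)
  also have "\<dots> = (\<lambda>w. f x * ip (dd G x w) u v + dd f x w * ip (G x) u v)"
    by (rule frechet_derivative_eqI[OF has_derivative_mult[OF has_derivative_dd[OF f] dip]])
  finally show ?thesis
    by (simp add: cov_deriv_def nabla_const S x metric_compatible[OF x, symmetric] algebra_simps)
qed

end

section \<open>Isometric immersions between open sets\<close>

text \<open>Serves twice: for the expression of the immersion in a pair of charts, and for changes
  of coordinates, which are isometric maps of equal dimension.\<close>

locale immersion_domain =
  M: riemannian_domain U G + N: riemannian_domain V H
  for U :: "(real ^ 'm::finite) set" and G and V :: "(real ^ 'n::finite) set" and H +
  fixes F :: "real ^ 'm \<Rightarrow> real ^ 'n"
  assumes smooth: "smooth_on U F"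
    and maps: "x \<in> U \<Longrightarrow> F x \<in> V"
    and isometric: "x \<in> U \<Longrightarrow> ip (G x) u v = ip (H (F x)) (dd F x u) (dd F x v)"
begin

lemma differentiable_map: "x \<in> U \<Longrightarrow> F differentiable (at x)"
  by (rule smooth_on_differentiable[OF smooth])

lemma differentiable_dd: "x \<in> U \<Longrightarrow> (\<lambda>y. dd F y v) differentiable (at x)"
  by (rule smooth_on_differentiable[OF smooth_on_dd[OF smooth]])

lemma linear_dd_map: "x \<in> U \<Longrightarrow> linear (dd F x)"
  by (rule linear_dd[OF differentiable_map])

section \<open>The second fundamental form: symmetry, bilinearity and normality\<close>

lemma sff_eq: "second_fund_form G H F x u v =
    nabla_along H F (\<lambda>y. dd F y v) x u - dd F x (christoffel_form G x u v)"
  by (simp add: second_fund_form_def nabla_const)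

text \<open>Second derivatives of \<open>F\<close> commute and the Christoffel form of
  \<open>H\<close> is symmetric, so the pull-back connection inherits freedom from torsion.\<close>

lemma nabla_along_dd_sym:
  assumes x: "x \<in> U"
  shows "nabla_along H F (\<lambda>y. dd F y v) x u = nabla_along H F (\<lambda>y. dd F y u) x v"
  using symmetric_second_derivative[OF M.open_domain x differentiable_map differentiable_dd[OF x], of v u]
    N.christoffel_form_sym[OF maps[OF x], of "dd F x u" "dd F x v"]
  by (simp add: nabla_along_def)

lemma sff_sym: "x \<in> U \<Longrightarrow> second_fund_form G H F x u v = second_fund_form G H F x v u"
  using nabla_along_dd_sym[of x v u] M.christoffel_form_sym[of x u v] by (simp add: sff_eq)

lemma linear_nabla_along:
  assumes "x \<in> U" "X differentiable (at x)"
  shows "linear (nabla_along H F X x)"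
  by (rule linearI)
    (simp_all add: nabla_along_def linear_add[OF linear_dd_map[OF assms(1)]]
      linear_scale[OF linear_dd_map[OF assms(1)]] linear_add[OF linear_dd[OF assms(2)]]
      linear_scale[OF linear_dd[OF assms(2)]] scaleR_add_right)

lemma linear_sff:
  assumes x: "x \<in> U"
  shows "linear (\<lambda>u. second_fund_form G H F x u v)" "linear (second_fund_form G H F x u)"
proof -
  note lin = linear_nabla_along[OF x differentiable_dd[OF x]]
  show *: "linear (\<lambda>u. second_fund_form G H F x u v)" for v
    by (rule linearI) (simp_all add: sff_eq linear_add[OF lin] linear_scale[OF lin]
      linear_add[OF linear_dd_map[OF x]] linear_scale[OF linear_dd_map[OF x]] scaleR_diff_right)
  \<comment> \<open>The second argument sits inside the field being differentiated, so its linearity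
    is taken over from the first one by symmetry.\<close>
  have "second_fund_form G H F x u = (\<lambda>v. second_fund_form G H F x v u)"
    by (rule ext) (rule sff_sym[OF x])
  then show "linear (second_fund_form G H F x u)" by (rule ssubst) (rule *)
qed

text \<open>The chain rule produces the derivative of \<open>H\<close> in direction
  \<open>dd F x u\<close>, and \<open>metric_compatible\<close> on the target splits it into the two
  Christoffel terms of \<open>nabla_along\<close>.\<close>

lemma has_derivative_ip_along:
  assumes x: "x \<in> U" and X: "X differentiable (at x)" and Y: "Y differentiable (at x)"
  shows "((\<lambda>y. ip (H (F y)) (X y) (Y y)) has_derivative
    (\<lambda>u. ip (H (F x)) (nabla_along H F X x u) (Y x)
      + ip (H (F x)) (X x) (nabla_along H F Y x u))) (at x)"
proof -
  have "((\<lambda>y. H (F y)) has_derivative (\<lambda>u. dd H (F x) (dd F x u))) (at x)"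
    using diff_chain_at[OF has_derivative_dd[OF differentiable_map[OF x]]
        has_derivative_dd[OF N.differentiable_metric[OF maps[OF x]]]]
    by (simp add: o_def)
  from has_derivative_ip[OF this has_derivative_dd[OF X] has_derivative_dd[OF Y]]
  show ?thesis
    by (rule has_derivative_eq_rhs)
      (simp add: fun_eq_iff nabla_along_def N.metric_compatible[OF maps[OF x], symmetric])
qed

text \<open>As in the Koszul formula: the three cyclic derivatives of the induced metric determine
  the tangential part of \<open>\<nabla>\<^sub>u (dF v)\<close>, which is thus \<open>dF (\<nabla>\<^sub>u v)\<close>.\<close>

lemma sff_normal:
  assumes x: "x \<in> U"
  shows "ip (H (F x)) (second_fund_form G H F x u v) (dd F x w) = 0"
proof -
  define T where "T a b c = ip (H (F x)) (nabla_along H F (\<lambda>y. dd F y b) x a) (dd F x c)" for a b c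
  have Tsym: "T a b c = T b a c" for a b c
    unfolding T_def by (simp only: nabla_along_dd_sym[OF x, of b a])
  \<comment> \<open>The derivative of the induced metric is computed twice: as that of
    \<open>G\<close>, and through the pull-back connection.\<close>
  have dG: "ip (dd G x a) b c = T a b c + T a c b" for a b c
  proof -
    have "((\<lambda>y. ip (H (F y)) (dd F y b) (dd F y c)) has_derivative
        (\<lambda>a. T a b c + ip (H (F x)) (dd F x b) (nabla_along H F (\<lambda>y. dd F y c) x a))) (at x)"
      unfolding T_def by (rule has_derivative_ip_along[OF x differentiable_dd[OF x] differentiable_dd[OF x]])
    then have "((\<lambda>y. ip (G y) b c) has_derivative
        (\<lambda>a. T a b c + ip (H (F x)) (dd F x b) (nabla_along H F (\<lambda>y. dd F y c) x a))) (at x)"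
      by (rule has_derivative_transform_within_open[OF _ M.open_domain x]) (simp add: isometric)
    moreover have "((\<lambda>y. ip (G y) b c) has_derivative (\<lambda>a. ip (dd G x a) b c)) (at x)"
      using has_derivative_ip[OF has_derivative_dd[OF M.differentiable_metric[OF x]]
          has_derivative_const has_derivative_const, of b c] by simp
    ultimately have "(\<lambda>a. ip (dd G x a) b c) =
        (\<lambda>a. T a b c + ip (H (F x)) (dd F x b) (nabla_along H F (\<lambda>y. dd F y c) x a))"
      by (rule has_derivative_unique[rotated])
    then have "ip (dd G x a) b c =
        T a b c + ip (H (F x)) (dd F x b) (nabla_along H F (\<lambda>y. dd F y c) x a)"
      by (rule fun_cong)
    also have "ip (H (F x)) (dd F x b) (nabla_along H F (\<lambda>y. dd F y c) x a) = T a c b"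
      unfolding T_def by (rule N.ip_sym[OF maps[OF x]])
    finally show ?thesis .
  qed
  have "ip (H (F x)) (dd F x (christoffel_form G x u v)) (dd F x w) =
      ip (G x) (christoffel_form G x u v) w"
    by (rule isometric[OF x, symmetric])
  also have "\<dots> = 1 / 2 * (T u v w + T u w v + (T v u w + T v w u) - (T w u v + T w v u))"
    unfolding M.koszul[OF x] dG ..
  \<comment> \<open>Symmetry of \<open>T\<close> in its first two arguments cancels the two negative
    terms against \<open>T u w v\<close> and \<open>T v w u\<close>; the remaining two are
    equal.\<close>
  also have "\<dots> = T u v w"
    using Tsym[of u w v] Tsym[of v w u] Tsym[of v u w] by simp
  finally show ?thesis by (simp add: sff_eq T_def)
qed

section \<open>The tension field and the biharmonic stress-energy tensor\<close>

lemma tension_normal: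
  "x \<in> U \<Longrightarrow> ip (H (F x)) (tension G H F x) (dd F x w) = 0"
  by (simp add: tension_def ip_metric_trace sff_normal) (simp add: metric_trace_def)

lemma differentiable_sff:
  assumes x: "x \<in> U"
  shows "(\<lambda>y. second_fund_form G H F y u v) differentiable (at x)"
proof -
  have 1: "(\<lambda>y. dd (\<lambda>z. dd F z v) y u) differentiable (at x)"
    by (rule smooth_on_differentiable[OF smooth_on_dd[OF smooth_on_dd[OF smooth]] x])
  have 2: "(\<lambda>y. christoffel_form H (F y) (dd F y u) (dd F y v)) differentiable (at x)"
    by (rule N.differentiable_christoffel_form[OF maps[OF x] differentiable_map[OF x]
          differentiable_dd[OF x] differentiable_dd[OF x]])
  \<comment> \<open>In the last term both the base point and the direction of \<open>dd F\<close>
    vary, which calls for \<open>has_derivative_dd_apply\<close> with the identity as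
    \<open>P\<close>.\<close>
  have "(\<lambda>y. christoffel_form G y u v) differentiable (at x)"
    by (rule M.differentiable_christoffel_form[OF x differentiable_ident differentiable_const
          differentiable_const])
  from has_derivative_dd_apply[OF M.open_domain x M.open_domain _ smooth
      has_derivative_ident has_derivative_dd[OF this]]
  have 3: "(\<lambda>y. dd F y (christoffel_form G y u v)) differentiable (at x)"
    unfolding differentiable_def by blast
  show ?thesis
    unfolding second_fund_form_def nabla_along_def nabla_const
    by (intro differentiable_diff differentiable_add 1 2 3)
qed

lemma differentiable_tension:
  assumes x: "x \<in> U"
  shows "tension G H F differentiable (at x)"
proof -
  have "(\<lambda>y. matrix_inv (G y) $ i $ j) differentiable (at x)" for i j
    by (rule differentiable_matrix_inv[OF M.differentiable_metric[OF x] M.open_domain x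
          M.det_nonzero])
  then have "(\<lambda>y. tension G H F y) differentiable (at x)"
    unfolding tension_def metric_trace_def
    by (intro differentiable_sum ballI differentiable_scaleR differentiable_sff x) auto
  then show ?thesis by simp
qed

lemma nabla_tension_tangential:
  assumes x: "x \<in> U"
  shows "ip (H (F x)) (dd F x w) (nabla_along H F (tension G H F) x u) =
    - ip (H (F x)) (second_fund_form G H F x u w) (tension G H F x)"
proof -
  let ?\<tau> = "tension G H F"
  have "((\<lambda>y. ip (H (F y)) (?\<tau> y) (dd F y w)) has_derivative (\<lambda>u. 0)) (at x)"
    by (rule has_derivative_transform_within_open[OF has_derivative_const M.open_domain x])
      (simp add: tension_normal)
  then have "ip (H (F x)) (nabla_along H F ?\<tau> x u) (dd F x w)
      + ip (H (F x)) (?\<tau> x) (nabla_along H F (\<lambda>y. dd F y w) x u) = 0"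
    using has_derivative_unique[OF has_derivative_ip_along[OF x differentiable_tension[OF x]
          differentiable_dd[OF x, of w]]] by (simp add: fun_eq_iff)
  \<comment> \<open>The tangential part of this derivative is orthogonal to the tension, so only the
    second fundamental form is seen.\<close>
  moreover have "nabla_along H F (\<lambda>y. dd F y w) x u =
      second_fund_form G H F x u w + dd F x (christoffel_form G x u w)"
    by (simp add: sff_eq)
  ultimately show ?thesis
    using N.ip_sym[OF maps[OF x], of "nabla_along H F ?\<tau> x u" "dd F x w"]
      N.ip_sym[OF maps[OF x], of "second_fund_form G H F x u w" "?\<tau> x"]
    by (simp add: tension_normal x)
qed

lemma differentiable_tension_norm:
  assumes "x \<in> U"
  shows "(\<lambda>y. ip (H (F y)) (tension G H F y) (tension G H F y)) differentiable (at x)"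
  using has_derivative_ip_along[OF assms differentiable_tension differentiable_tension] assms
  unfolding differentiable_def by blast

text \<open>Write \<open>t\<close> for the squared norm of the tension. Each product of
  \<open>dd F\<close> with the derivative of the tension is \<open>- t / m\<close> times the metric,
  whose trace is \<open>m\<close>. The coefficient of \<open>t\<close> is therefore
  \<open>1/2\<close> from the first term, \<open>-1\<close> from the trace and \<open>1/m\<close>
  from each of the last two.\<close>

lemma bistress_pseudo_umbilical:
  assumes x: "x \<in> U"
    and umb: "\<And>u v. ip (H (F x)) (second_fund_form G H F x u v) (tension G H F x) =
      1 / real CARD('m) * ip (H (F x)) (tension G H F x) (tension G H F x) * ip (G x) u v"
  shows "bistress G H F x u v =
    (2 / real CARD('m) - 1 / 2) * ip (H (F x)) (tension G H F x) (tension G H F x) * ip (G x) u v"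
proof -
  define t where "t = ip (H (F x)) (tension G H F x) (tension G H F x)"
  have D: "ip (H (F x)) (dd F x a) (nabla_along H F (tension G H F) x b) =
      (- (t / real CARD('m))) * ip (G x) a b" for a b
    unfolding nabla_tension_tangential[OF x] umb t_def[symmetric] M.ip_sym[OF x, of b a] by simp
  have "metric_trace (G x) (\<lambda>a b. (- (t / real CARD('m))) * ip (G x) a b) = - t"
    unfolding metric_trace_scale metric_trace_ip[OF M.det_nonzero[OF x] M.symmetric[OF x]] by simp
  then show ?thesis
    unfolding bistress_def Let_def D t_def[symmetric] M.ip_sym[OF x, of v u]
    by (simp add: algebra_simps)
qed

end

section \<open>Restriction, composition and changes of coordinates\<close>

text \<open>Shrinks domain and target until the target of one map is the domain of the next, as the
  composition formula requires.\<close>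

lemma immersion_domain_restrict:
  assumes "immersion_domain U G V H F" and "open U'" "U' \<subseteq> U" and "open V'" "V' \<subseteq> V"
    and maps': "\<And>x. x \<in> U' \<Longrightarrow> F x \<in> V'"
  shows "immersion_domain U' G V' H F"
proof -
  interpret immersion_domain U G V H F by fact
  show ?thesis
  proof unfold_locales
    show "smooth_on U' F" "smooth_on U' G" "smooth_on V' H"
      using smooth_on_subset[OF smooth] smooth_on_subset[OF M.smooth_metric]
        smooth_on_subset[OF N.smooth_metric] assms by auto
  qed (use assms M.symmetric M.positive N.symmetric N.positive isometric in \<open>auto simp: subset_iff\<close>)
qed

text \<open>A composite with a change of coordinates agrees with the direct coordinate expression
  only on an overlap of charts. Agreement on an open set suffices, since derivatives are
  local.\<close>

lemma second_fund_form_cong: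
  assumes "open U" "x \<in> U" "\<And>y. y \<in> U \<Longrightarrow> F y = F' y"
  shows "second_fund_form G H F x = second_fund_form G H F' x"
proof -
  have D: "dd F y = dd F' y" if "y \<in> U" for y
    by (rule frechet_derivative_cong_open[OF assms(1) that assms(3)])
  have "dd (\<lambda>y. dd F y v) x = dd (\<lambda>y. dd F' y v) x" for v
    by (rule frechet_derivative_cong_open[OF assms(1,2)]) (simp add: D)
  then show ?thesis
    by (simp add: fun_eq_iff second_fund_form_def nabla_along_def D assms)
qed

lemma tension_cong:
  assumes "open U" "x \<in> U" "\<And>y. y \<in> U \<Longrightarrow> F y = F' y"
  shows "tension G H F x = tension G H F' x"
  unfolding tension_def using second_fund_form_cong[OF assms] by simp

text \<open>The Christoffel term of the middle metric \<open>H\<close> enters the first summand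
  positively and the second negatively, each time under \<open>dd K\<close>, and cancels. The rest
  is the chain rule for second derivatives.\<close>

lemma second_fund_form_compose:
  assumes "immersion_domain U G V H F" "immersion_domain V H W L K" and x: "x \<in> U"
  shows "second_fund_form G L (K \<circ> F) x u v =
    dd K (F x) (second_fund_form G H F x u v)
      + second_fund_form H L K (F x) (dd F x u) (dd F x v)"
proof -
  interpret F: immersion_domain U G V H F by fact
  interpret K: immersion_domain V H W L K by fact
  have chain: "dd (K \<circ> F) y w = dd K (F y) (dd F y w)" if "y \<in> U" for y w
    by (simp add: frechet_derivative_compose F.differentiable_map K.differentiable_map F.maps that)
  have "dd (\<lambda>y. dd (K \<circ> F) y v) x = dd (\<lambda>y. dd K (F y) (dd F y v)) x"
    by (rule frechet_derivative_cong_open[OF F.M.open_domain x]) (simp add: chain)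
  also have "\<dots> = (\<lambda>u. dd (\<lambda>z. dd K z (dd F x v)) (F x) (dd F x u)
      + dd K (F x) (dd (\<lambda>y. dd F y v) x u))"
    by (rule frechet_derivative_eqI, rule has_derivative_dd_apply[OF F.M.open_domain x
          F.N.open_domain F.maps K.smooth has_derivative_dd[OF F.differentiable_map[OF x]]
          has_derivative_dd[OF F.differentiable_dd[OF x]]])
  finally show ?thesis
    unfolding second_fund_form_def nabla_along_def nabla_const
    by (simp add: chain[OF x] linear_add linear_diff K.linear_dd_map[OF F.maps[OF x]])
qed

text \<open>Applied to changes of coordinates, this replaces the transformation law of the Christoffel
  symbols.\<close>

lemma local_isometry_sff_zero:
  fixes F :: "real ^ 'm::finite \<Rightarrow> real ^ 'm"
  assumes "immersion_domain U G V H F" and x: "x \<in> U"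
  shows "second_fund_form G H F x u v = 0"
proof -
  interpret immersion_domain U G V H F by fact
  \<comment> \<open>A vector in the kernel of \<open>dd F x\<close> has length zero by
    \<open>isometric\<close>. Equal dimensions then give surjectivity, and being normal to the image
    means being normal to everything.\<close>
  have "inj (dd F x)"
    unfolding linear_injective_0[OF linear_dd_map[OF x]]
    using M.positive[OF x] isometric[OF x] by (metis ip_linear(7) less_irrefl)
  then have "surj (dd F x)"
    using linear_injective_imp_surjective linear_dd_map[OF x] by blast
  then have "ip (H (F x)) (second_fund_form G H F x u v) w = ip (H (F x)) 0 w" for w
    using sff_normal[OF x, of u v] by (metis ip_linear(7) surjD)
  then show ?thesis by (rule N.ip_unique[OF maps[OF x]])
qed

text \<open>Change of the target chart: \<open>K\<close> has vanishing second fundamental form, and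
  the linear map \<open>dd K (F x)\<close> passes through the trace.\<close>

lemma tension_compose_left:
  fixes K :: "real ^ 'n::finite \<Rightarrow> real ^ 'n"
  assumes F: "immersion_domain U G V H F" and K: "immersion_domain V H W L K" and x: "x \<in> U"
  shows "tension G L (K \<circ> F) x = dd K (F x) (tension G H F x)"
proof -
  interpret F: immersion_domain U G V H F by fact
  interpret K: immersion_domain V H W L K by fact
  have "second_fund_form G L (K \<circ> F) x = (\<lambda>u v. dd K (F x) (second_fund_form G H F x u v))"
    by (intro ext)
      (simp add: second_fund_form_compose[OF F K x] local_isometry_sff_zero[OF K F.maps[OF x]])
  then show ?thesis
    unfolding tension_def linear_metric_trace[OF K.linear_dd_map[OF F.maps[OF x]]] by simp
qed

text \<open>Change of the source chart: now the second fundamental form of \<open>F\<close>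
  vanishes, and what is left is the form of \<open>K\<close> pulled back by \<open>dd F x\<close>,
  whose trace is unchanged because \<open>F\<close> is isometric.\<close>

lemma tension_compose_right:
  fixes F :: "real ^ 'm::finite \<Rightarrow> real ^ 'm"
  assumes F: "immersion_domain U G V H F" and K: "immersion_domain V H W L K" and x: "x \<in> U"
  shows "tension G L (K \<circ> F) x = tension H L K (F x)"
proof -
  interpret F: immersion_domain U G V H F by fact
  interpret K: immersion_domain V H W L K by fact
  note y = F.maps[OF x]
  have "second_fund_form G L (K \<circ> F) x =
      (\<lambda>u v. second_fund_form H L K (F x) (dd F x u) (dd F x v))"
    by (intro ext) (simp add: second_fund_form_compose[OF F K x] local_isometry_sff_zero[OF F x]
        linear_0[OF K.linear_dd_map[OF y]])
  then have "tension G L (K \<circ> F) x =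
      metric_trace (G x) (\<lambda>u v. second_fund_form H L K (F x) (dd F x u) (dd F x v))"
    by (simp add: tension_def)
  also have "\<dots> = tension H L K (F x)"
    unfolding tension_def
    by (rule metric_trace_pullback[OF K.linear_sff(2,1)[OF y] F.linear_dd_map[OF x]
          F.M.det_nonzero[OF x] F.N.det_nonzero[OF y] F.isometric[OF x]])
  finally show ?thesis .
qed

section \<open>Charts\<close>

lemma chart_inv_chart: "is_chart c \<Longrightarrow> p \<in> fst c \<Longrightarrow> chart_inv c (snd c p) = p"
  unfolding is_chart_def by (blast intro: homeomorphism_apply1)

lemma open_chart_image:
  assumes c: "is_chart c" and S: "open S"
  shows "open (snd c ` (fst c \<inter> S))"
proof -
  have "snd c ` (fst c \<inter> S) = snd c ` fst c \<inter> chart_inv c -` S"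
    by (auto simp: chart_inv_chart[OF c])
  moreover have "open (snd c ` fst c \<inter> chart_inv c -` S)"
    using c by (intro continuous_open_preimage S) (auto simp: is_chart_def homeomorphism_def)
  ultimately show ?thesis by simp
qed

lemma open_local_dom:
  assumes "is_chart c" "is_chart d" "continuous_on UNIV \<phi>"
  shows "open (local_dom c d \<phi>)"
proof -
  have "open (\<phi> -` fst d)"
    using assms by (intro open_vimage) (auto simp: is_chart_def)
  then show ?thesis unfolding local_dom_def by (rule open_chart_image[OF assms(1)])
qed

lemma local_rep_chart:
  "is_chart c \<Longrightarrow> p \<in> fst c \<Longrightarrow> local_rep c d \<phi> (snd c p) = snd d (\<phi> p)"
  by (simp add: local_rep_def chart_inv_chart)

lemma riemannian_manifoldD:
  fixes A :: "('a::{t2_space,second_countable_topology}, 'm::finite) chart set"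
  assumes "riemannian_manifold A g"
  shows "c \<in> A \<Longrightarrow> is_chart c" "\<exists>c\<in>A. p \<in> fst c" "connected (UNIV :: 'a set)"
  using assms unfolding riemannian_manifold_def smooth_atlas_def by blast+

lemma riemannian_domain_chart:
  assumes "riemannian_manifold A g" "c \<in> A"
  shows "riemannian_domain (snd c ` fst c) (g c)"
  using assms
  unfolding riemannian_manifold_def smooth_atlas_def riemannian_metric_def is_chart_def
  by unfold_locales auto

lemma riemannian_domain_subset:
  assumes "riemannian_domain U G" "open U'" "U' \<subseteq> U"
  shows "riemannian_domain U' G"
proof -
  interpret riemannian_domain U G by fact
  show ?thesis
    by unfold_locales
      (use assms symmetric positive smooth_on_subset[OF smooth_metric] in \<open>auto simp: subset_iff\<close>)
qed

lemma immersion_domain_chart: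
  assumes M: "riemannian_manifold A g" and N: "riemannian_manifold B h"
    and \<phi>: "riemannian_immersion A g B h \<phi>" and c: "c \<in> A" and d: "d \<in> B"
  shows "immersion_domain (local_dom c d \<phi>) (g c) (snd d ` fst d) (h d) (local_rep c d \<phi>)"
proof -
  have "open (local_dom c d \<phi>)"
    using \<phi> riemannian_manifoldD(1)[OF M c] riemannian_manifoldD(1)[OF N d]
    by (intro open_local_dom) (auto simp: riemannian_immersion_def smooth_map_def)
  then interpret M: riemannian_domain "local_dom c d \<phi>" "g c"
    by (rule riemannian_domain_subset[OF riemannian_domain_chart[OF M c]])
      (auto simp: local_dom_def)
  interpret N: riemannian_domain "snd d ` fst d" "h d"
    by (rule riemannian_domain_chart[OF N d])
  show ?thesis
  proof unfold_locales
    show "local_rep c d \<phi> x \<in> snd d ` fst d" if "x \<in> local_dom c d \<phi>" for x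
      using that by (auto simp: local_dom_def local_rep_chart riemannian_manifoldD(1)[OF M c])
  qed (use \<phi> c d in \<open>auto simp: riemannian_immersion_def smooth_map_def\<close>)
qed

text \<open>The tensor transformation rule in \<open>riemannian_metric\<close> is exactly the
  isometry condition for a change of coordinates.\<close>

lemma immersion_domain_transition:
  assumes M: "riemannian_manifold A g" and c: "c \<in> A" and c': "c' \<in> A"
  shows "immersion_domain (local_dom c c' id) (g c) (snd c' ` fst c') (g c') (local_rep c c' id)"
proof -
  have "open (local_dom c c' id)"
    using riemannian_manifoldD(1)[OF M c] riemannian_manifoldD(1)[OF M c']
    by (intro open_local_dom) (auto intro: continuous_on_id')
  then interpret M: riemannian_domain "local_dom c c' id" "g c"
    by (rule riemannian_domain_subset[OF riemannian_domain_chart[OF M c]])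
      (auto simp: local_dom_def)
  interpret N: riemannian_domain "snd c' ` fst c'" "g c'"
    by (rule riemannian_domain_chart[OF M c'])
  show ?thesis
  proof unfold_locales
    show "local_rep c c' id x \<in> snd c' ` fst c'" if "x \<in> local_dom c c' id" for x
      using that by (auto simp: local_dom_def local_rep_chart riemannian_manifoldD(1)[OF M c])
    show "smooth_on (local_dom c c' id) (local_rep c c' id)"
      using M c c' by (auto simp: riemannian_manifold_def smooth_atlas_def)
    show "ip (g c x) u v = ip (g c' (local_rep c c' id x)) (dd (local_rep c c' id) x u)
        (dd (local_rep c c' id) x v)" if "x \<in> local_dom c c' id" for x u v
      using M c c' that by (auto simp: riemannian_manifold_def riemannian_metric_def)
  qed
qed

section \<open>The squared norm of the tension as a function on the manifold\<close>

text \<open>The square is used instead of the norm because it is differentiable even where the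
  tension vanishes.\<close>

definition tension_sq ::
  "(real ^ 'm \<Rightarrow> real ^ 'm ^ 'm) \<Rightarrow> (real ^ 'n \<Rightarrow> real ^ 'n ^ 'n) \<Rightarrow>
   (real ^ 'm \<Rightarrow> real ^ 'n::finite) \<Rightarrow> real ^ 'm::finite \<Rightarrow> real" where
  "tension_sq G H F x = ip (H (F x)) (tension G H F x) (tension G H F x)"

text \<open>The tension vector is transformed by the differential of the change of target
  coordinates, which preserves lengths.\<close>

lemma tension_sq_change_target:
  assumes M: "riemannian_manifold A g" and N: "riemannian_manifold B h"
    and \<phi>: "riemannian_immersion A g B h \<phi>" and c: "c \<in> A" and d: "d \<in> B" "d' \<in> B"
    and p: "p \<in> fst c" "\<phi> p \<in> fst d" "\<phi> p \<in> fst d'"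
  shows "tension_sq (g c) (h d') (local_rep c d' \<phi>) (snd c p) =
    tension_sq (g c) (h d) (local_rep c d \<phi>) (snd c p)"
proof -
  let ?F = "local_rep c d \<phi>" and ?F' = "local_rep c d' \<phi>" and ?K = "local_rep d d' id"
  define W where "W = local_dom d d' id"
  \<comment> \<open>Only points that \<open>\<phi>\<close> sends into both target charts are kept,
    so that \<open>?F\<close> maps \<open>U\<close> into the domain \<open>W\<close> of
    \<open>?K\<close>.\<close>
  define U where "U = snd c ` (fst c \<inter> \<phi> -` (fst d \<inter> fst d'))"
  note ch = riemannian_manifoldD(1)[OF M c] riemannian_manifoldD(1)[OF N d(1)]
    riemannian_manifoldD(1)[OF N d(2)]
  have K: "immersion_domain W (h d) (snd d' ` fst d') (h d') ?K"
    unfolding W_def by (rule immersion_domain_transition[OF N d])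
  interpret K: immersion_domain W "h d" "snd d' ` fst d'" "h d'" ?K by (rule K)
  have oU: "open U" unfolding U_def
  proof (rule open_chart_image[OF ch(1)])
    show "open (\<phi> -` (fst d \<inter> fst d'))"
      using ch \<phi> by (intro open_vimage) (auto simp: is_chart_def riemannian_immersion_def smooth_map_def)
  qed
  have F: "immersion_domain U (g c) W (h d) ?F"
  proof (rule immersion_domain_restrict[OF immersion_domain_chart[OF M N \<phi> c d(1)] oU])
    show "open W" by (rule K.M.open_domain)
  qed (auto simp: U_def W_def local_dom_def local_rep_chart ch)
  have x: "snd c p \<in> U" using p by (auto simp: U_def)
  interpret F: immersion_domain U "g c" W "h d" ?F by (rule F)
  have comp: "(?K \<circ> ?F) y = ?F' y" if "y \<in> U" for y
    using that by (auto simp: U_def local_rep_chart ch)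
  have \<tau>: "tension (g c) (h d') ?F' (snd c p) =
      dd ?K (?F (snd c p)) (tension (g c) (h d) ?F (snd c p))"
    using tension_compose_left[OF F K x] tension_cong[OF oU x comp] by simp
  have "?F' (snd c p) = ?K (?F (snd c p))" using comp[OF x] by simp
  then show ?thesis
    unfolding tension_sq_def \<tau> by (simp only: K.isometric[OF F.maps[OF x]])
qed

text \<open>With the target chart fixed, the components of the tension and the matrix of
  \<open>h\<close> at the image point are literally the same on both sides.\<close>

lemma tension_sq_change_source:
  assumes M: "riemannian_manifold A g" and N: "riemannian_manifold B h"
    and \<phi>: "riemannian_immersion A g B h \<phi>" and c: "c \<in> A" "c' \<in> A" and d: "d \<in> B"
    and p: "p \<in> fst c" "p \<in> fst c'" "\<phi> p \<in> fst d"
  shows "tension_sq (g c) (h d) (local_rep c d \<phi>) (snd c p) =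
    tension_sq (g c') (h d) (local_rep c' d \<phi>) (snd c' p)"
proof -
  let ?F = "local_rep c d \<phi>" and ?F' = "local_rep c' d \<phi>" and ?K = "local_rep c c' id"
  define V where "V = local_dom c' d \<phi>"
  define U where "U = snd c ` (fst c \<inter> (fst c' \<inter> \<phi> -` fst d))"
  note ch = riemannian_manifoldD(1)[OF M c(1)] riemannian_manifoldD(1)[OF M c(2)]
    riemannian_manifoldD(1)[OF N d]
  have F: "immersion_domain V (g c') (snd d ` fst d) (h d) ?F'"
    unfolding V_def by (rule immersion_domain_chart[OF M N \<phi> c(2) d])
  interpret F: immersion_domain V "g c'" "snd d ` fst d" "h d" ?F' by (rule F)
  have oU: "open U" unfolding U_def
  proof (rule open_chart_image[OF ch(1)], rule open_Int)
    show "open (fst c')" using ch(2) by (simp add: is_chart_def)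
    show "open (\<phi> -` fst d)"
      using ch \<phi> by (intro open_vimage) (auto simp: is_chart_def riemannian_immersion_def smooth_map_def)
  qed
  have K: "immersion_domain U (g c) V (g c') ?K"
  proof (rule immersion_domain_restrict[OF immersion_domain_transition[OF M c] oU])
    show "open V" by (rule F.M.open_domain)
  qed (auto simp: U_def V_def local_dom_def local_rep_chart ch)
  have x: "snd c p \<in> U" using p by (auto simp: U_def)
  have comp: "(?F' \<circ> ?K) y = ?F y" if "y \<in> U" for y
    using that by (auto simp: U_def local_rep_chart ch)
  have Kx: "?K (snd c p) = snd c' p" using p by (simp add: local_rep_chart ch)
  have \<tau>: "tension (g c) (h d) ?F (snd c p) = tension (g c') (h d) ?F' (snd c' p)"
    using tension_compose_right[OF K F x] tension_cong[OF oU x comp] Kx by simp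
  show ?thesis
    unfolding tension_sq_def \<tau> using p by (simp add: local_rep_chart ch)
qed

lemma tension_sq_global:
  assumes M: "riemannian_manifold A g" and N: "riemannian_manifold B h"
    and \<phi>: "riemannian_immersion A g B h \<phi>"
  obtains E where "\<And>c d p. \<lbrakk>c \<in> A; d \<in> B; p \<in> fst c; \<phi> p \<in> fst d\<rbrakk> \<Longrightarrow>
    tension_sq (g c) (h d) (local_rep c d \<phi>) (snd c p) = E p"
proof -
  \<comment> \<open>One pair of charts is chosen for each pair of points to define \<open>E\<close>.
    An arbitrary pair is compared with it in two moves, first changing the target chart and then the
    source chart.\<close>
  obtain c0 d0 where c0: "\<And>p. c0 p \<in> A \<and> p \<in> fst (c0 p)" and d0: "\<And>q. d0 q \<in> B \<and> q \<in> fst (d0 q)"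
    using riemannian_manifoldD(2)[OF M] riemannian_manifoldD(2)[OF N] by metis
  show ?thesis
  proof (rule that)
    fix c d p assume "c \<in> A" "d \<in> B" "p \<in> fst c" "\<phi> p \<in> fst d"
    then show "tension_sq (g c) (h d) (local_rep c d \<phi>) (snd c p) =
        tension_sq (g (c0 p)) (h (d0 (\<phi> p))) (local_rep (c0 p) (d0 (\<phi> p)) \<phi>) (snd (c0 p) p)"
      using tension_sq_change_target[OF M N \<phi>, of c "d0 (\<phi> p)" d p]
        tension_sq_change_source[OF M N \<phi>, of c "c0 p" "d0 (\<phi> p)" p] c0[of p] d0[of "\<phi> p"]
      by simp
  qed
qed

text \<open>A zero derivative makes the coordinate expression constant on a ball. The global
  function \<open>E\<close> is therefore locally constant, and connectedness of the manifold
  finishes the argument.\<close>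

lemma constant_tension_sq:
  assumes M: "riemannian_manifold A g" and N: "riemannian_manifold B h"
    and \<phi>: "riemannian_immersion A g B h \<phi>"
    and zero: "\<And>c d x w. \<lbrakk>c \<in> A; d \<in> B; x \<in> local_dom c d \<phi>\<rbrakk> \<Longrightarrow>
      dd (tension_sq (g c) (h d) (local_rep c d \<phi>)) x w = 0"
  obtains K where "\<And>c d x. \<lbrakk>c \<in> A; d \<in> B; x \<in> local_dom c d \<phi>\<rbrakk> \<Longrightarrow>
      tension_sq (g c) (h d) (local_rep c d \<phi>) x = K"
proof -
  obtain E where E: "\<And>c d p. \<lbrakk>c \<in> A; d \<in> B; p \<in> fst c; \<phi> p \<in> fst d\<rbrakk> \<Longrightarrow>
      tension_sq (g c) (h d) (local_rep c d \<phi>) (snd c p) = E p"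
    using tension_sq_global[OF M N \<phi>] by blast
  have "E constant_on UNIV"
  proof (rule locally_constant_imp_constant[OF riemannian_manifoldD(3)[OF M]])
    fix p :: 'a
    obtain c where c: "c \<in> A" "p \<in> fst c" using riemannian_manifoldD(2)[OF M] by blast
    obtain d where d: "d \<in> B" "\<phi> p \<in> fst d" using riemannian_manifoldD(2)[OF N] by blast
    let ?f = "tension_sq (g c) (h d) (local_rep c d \<phi>)"
    interpret I: immersion_domain "local_dom c d \<phi>" "g c" "snd d ` fst d" "h d" "local_rep c d \<phi>"
      by (rule immersion_domain_chart[OF M N \<phi> c(1) d(1)])
    have ch: "is_chart c" by (rule riemannian_manifoldD(1)[OF M c(1)])
    have x: "snd c p \<in> local_dom c d \<phi>" using c d by (auto simp: local_dom_def)
    obtain r where r: "r > 0" "ball (snd c p) r \<subseteq> local_dom c d \<phi>"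
      using I.M.open_domain x openE by blast
    have const: "?f y = ?f (snd c p)" if y: "y \<in> ball (snd c p) r" for y
    proof -
      have "(?f has_derivative (\<lambda>w. 0)) (at z within ball (snd c p) r)"
        if z: "z \<in> ball (snd c p) r" for z
      proof -
        have zU: "z \<in> local_dom c d \<phi>" using r z by blast
        have "?f differentiable (at z)"
          using I.differentiable_tension_norm[OF zU] by (simp add: tension_sq_def[abs_def])
        moreover have "dd ?f z = (\<lambda>w. 0)" using zero[OF c(1) d(1) zU] by (simp add: fun_eq_iff)
        ultimately show ?thesis
          using has_derivative_dd[of ?f z] by (simp add: has_derivative_at_withinI)
      qed
      then have "\<exists>k. \<forall>y\<in>ball (snd c p) r. ?f y = k"
        by (rule has_derivative_zero_constant[OF convex_ball])
      then obtain k where k: "\<forall>y\<in>ball (snd c p) r. ?f y = k" ..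
      show ?thesis using bspec[OF k y] bspec[OF k, of "snd c p"] r by simp
    qed
    define T where "T = fst c \<inter> snd c -` ball (snd c p) r"
    have "openin (top_of_set UNIV) T"
      unfolding T_def openin_open using ch
      by (intro exI[of _ "fst c \<inter> snd c -` ball (snd c p) r"] conjI)
        (auto simp: is_chart_def homeomorphism_def intro!: continuous_open_preimage)
    moreover have "p \<in> T" using c r by (simp add: T_def)
    moreover have "E q = E p" if q: "q \<in> T" for q
    proof -
      have qc: "q \<in> fst c" "snd c q \<in> ball (snd c p) r" using q by (auto simp: T_def)
      then have "snd c q \<in> local_dom c d \<phi>" using r by blast
      \<comment> \<open>Membership in \<open>local_dom\<close> only provides some point with the
        same coordinates that \<open>\<phi>\<close> sends into \<open>fst d\<close>; injectivity of
        the chart identifies it with \<open>q\<close>.\<close>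
      then obtain q' where q': "q' \<in> fst c" "\<phi> q' \<in> fst d" "snd c q = snd c q'"
        by (auto simp: local_dom_def)
      have "q = q'"
        by (rule trans[OF chart_inv_chart[OF ch qc(1), symmetric]])
          (simp only: q'(3) chart_inv_chart[OF ch q'(1)])
      then have "\<phi> q \<in> fst d" using q'(2) by (rule ssubst)
      from E[OF c(1) d(1) qc(1) this] E[OF c(1) d(1) c(2) d(2)] const[OF qc(2)]
      show ?thesis by simp
    qed
    ultimately show "\<exists>T. openin (top_of_set UNIV) T \<and> p \<in> T \<and> (\<forall>q\<in>T. E q = E p)"
      by blast
  qed
  then obtain K where K: "\<And>p. E p = K" unfolding constant_on_def by blast
  show ?thesis
  proof (rule that)
    fix c d x assume "c \<in> A" "d \<in> B" "x \<in> local_dom c d \<phi>"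
    then show "tension_sq (g c) (h d) (local_rep c d \<phi>) x = K"
      using E[of c d] K by (auto simp: local_dom_def)
  qed
qed

section \<open>Vanishing and parallelism of the stress-energy tensor according to the
  dimension\<close>

theorem proposition4p5:
  fixes A :: "('a::{t2_space,second_countable_topology}, 'm::finite) chart set"
    and g :: "('a, 'm) chart \<Rightarrow> real ^ 'm \<Rightarrow> real ^ 'm ^ 'm"
    and B :: "('b::{t2_space,second_countable_topology}, 'n::finite) chart set"
    and h :: "('b, 'n) chart \<Rightarrow> real ^ 'n \<Rightarrow> real ^ 'n ^ 'n"
    and \<phi> :: "'a \<Rightarrow> 'b"
  assumes "riemannian_manifold A g" and "riemannian_manifold B h"
    and "riemannian_immersion A g B h \<phi>"
    and "\<not> minimal A g B h \<phi>"
    and "pseudo_umbilical A g B h \<phi>"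
  shows "(CARD('m) = 4 \<longrightarrow> bistress_vanishes A g B h \<phi> \<and> bistress_parallel A g B h \<phi>) \<and>
         (CARD('m) \<noteq> 4 \<longrightarrow> (bistress_parallel A g B h \<phi> \<longleftrightarrow> constant_tension_norm A g B h \<phi>))"
proof -
  \<comment> \<open>The factor by which the stress-energy tensor differs from the squared tension
    norm times the metric; it vanishes exactly in dimension 4.\<close>
  define k where "k = 2 / real CARD('m) - 1 / 2"
  have k: "k = 0 \<longleftrightarrow> CARD('m) = 4"
  proof -
    have "k = 0 \<longleftrightarrow> real CARD('m) = 4" by (simp add: k_def field_simps)
    then show ?thesis by linarith
  qed
  note im = immersion_domain_chart[OF assms(1-3)]
  define f where "f c d = tension_sq (g c) (h d) (local_rep c d \<phi>)" for c d
  have diff: "f c d differentiable (at x)" if "c \<in> A" "d \<in> B" "x \<in> local_dom c d \<phi>" for c d x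
    using immersion_domain.differentiable_tension_norm[OF im[OF that(1,2)] that(3)]
    by (simp add: f_def tension_sq_def[abs_def])
  have S: "bistress (g c) (h d) (local_rep c d \<phi>) x u v = k * f c d x * ip (g c x) u v"
    if "c \<in> A" "d \<in> B" "x \<in> local_dom c d \<phi>" for c d x u v
    unfolding f_def tension_sq_def k_def
    by (rule immersion_domain.bistress_pseudo_umbilical[OF im[OF that(1,2)] that(3)])
      (use assms(5) that in \<open>auto simp: pseudo_umbilical_def Let_def\<close>)
  have dS: "cov_deriv (g c) (bistress (g c) (h d) (local_rep c d \<phi>)) x w u v =
      k * dd (f c d) x w * ip (g c x) u v"
    if "c \<in> A" "d \<in> B" "x \<in> local_dom c d \<phi>" for c d x w u v
  proof -
    interpret immersion_domain "local_dom c d \<phi>" "g c" "snd d ` fst d" "h d" "local_rep c d \<phi>"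
      by (rule im[OF that(1,2)])
    have D: "((\<lambda>y. k * f c d y) has_derivative (\<lambda>w. k * dd (f c d) x w)) (at x)"
      by (rule has_derivative_mult_right[OF has_derivative_dd[OF diff[OF that]]])
    then have "(\<lambda>y. k * f c d y) differentiable (at x)"
      unfolding differentiable_def by blast
    from M.cov_deriv_conformal[OF that(3) this S[OF that(1,2)], of w u v]
    show ?thesis by (simp only: frechet_derivative_eqI[OF D])
  qed
  have "bistress_parallel A g B h \<phi> \<longleftrightarrow> constant_tension_norm A g B h \<phi>" if "k \<noteq> 0"
  proof
    assume par: "bistress_parallel A g B h \<phi>"
    have "dd (tension_sq (g c) (h d) (local_rep c d \<phi>)) x w = 0"
      if cd: "c \<in> A" "d \<in> B" "x \<in> local_dom c d \<phi>" for c d x w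
    proof -
      interpret immersion_domain "local_dom c d \<phi>" "g c" "snd d ` fst d" "h d" "local_rep c d \<phi>"
        by (rule im[OF cd(1,2)])
      \<comment> \<open>Any nonzero vector would do: the metric is positive on it, so this factor
        and \<open>k\<close> can be cancelled from \<open>dS\<close>.\<close>
      let ?u = "axis undefined 1 :: real ^ 'm"
      have "k * dd (f c d) x w * ip (g c x) ?u ?u = 0"
        using par cd dS[OF cd] by (simp add: bistress_parallel_def)
      moreover have "ip (g c x) ?u ?u > 0"
        by (rule M.positive[OF cd(3)]) (simp add: axis_eq_0_iff)
      ultimately show ?thesis using \<open>k \<noteq> 0\<close> by (simp add: f_def)
    qed
    then obtain K where "\<And>c d x. \<lbrakk>c \<in> A; d \<in> B; x \<in> local_dom c d \<phi>\<rbrakk> \<Longrightarrow>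
        tension_sq (g c) (h d) (local_rep c d \<phi>) x = K"
      using constant_tension_sq[OF assms(1-3)] by blast
    then show "constant_tension_norm A g B h \<phi>"
      unfolding constant_tension_norm_def Let_def
      by (intro exI[of _ "sqrt K"]) (simp add: tension_sq_def)
  next
    assume "constant_tension_norm A g B h \<phi>"
    then obtain K where K: "\<And>c d x. \<lbrakk>c \<in> A; d \<in> B; x \<in> local_dom c d \<phi>\<rbrakk> \<Longrightarrow> sqrt (f c d x) = K"
      unfolding constant_tension_norm_def f_def tension_sq_def Let_def by blast
    have "dd (f c d) x w = 0" if cd: "c \<in> A" "d \<in> B" "x \<in> local_dom c d \<phi>" for c d x w
    proof -
      interpret immersion_domain "local_dom c d \<phi>" "g c" "snd d ` fst d" "h d" "local_rep c d \<phi>"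
        by (rule im[OF cd(1,2)])
      \<comment> \<open>Equal norms give equal squares, as \<open>sqrt\<close> is injective on all
        reals. So \<open>f c d\<close> is constant on an open set around \<open>x\<close> and has
        zero derivative there.\<close>
      have "f c d y = f c d x" if "y \<in> local_dom c d \<phi>" for y
        using K[OF cd] K[OF cd(1,2) that] by (metis real_sqrt_eq_iff)
      then have "dd (f c d) x = dd (\<lambda>y. f c d x) x"
        by (rule frechet_derivative_cong_open[OF M.open_domain cd(3)])
      then show ?thesis by simp
    qed
    then show "bistress_parallel A g B h \<phi>"
      by (simp add: bistress_parallel_def dS)
  qed
  moreover have "bistress_vanishes A g B h \<phi> \<and> bistress_parallel A g B h \<phi>" if "k = 0"
    by (simp add: bistress_vanishes_def bistress_parallel_def S dS that)
  ultimately show ?thesis using k by blast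
qed

end
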